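(* Let $\mathcal{E}$ be a topos. For any modality $\mu$ on $\mathcal{E}$ and any object $X$, the relation $$R_\mu(X):=\{\langle x,y\rangle\in X\times X:\mu(x=y)\}$$ is an equivalence relation on $X$. Its quotient $Q_\mu(X)$ is functorial in $X$ and the functor $Q_\mu$ preserves finite products. Moreover, the quotient map $q_\mu^X:X\to Q_\mu(X)$ is natural in $X$.
   Context: Expressions are interpreted in the internal language (local set theory $S$) of $\mathcal{E}$. A modality $\mu$ is the internal-language equivalent of a Lawvere–Tierney topology (local operator) $j:\Omega\to\Omega$: it assigns to each formula $\alpha$ (term of type $\Omega$) a formula $\mu(\alpha)$ such that (1) $\alpha\vdash_S\mu(\alpha)$; (2) if $\alpha\vdash_S\beta$ then $\mu(\alpha)\vdash_S\mu(\beta)$; (3) $\mu(\mu(\alpha))\vdash_S\mu(\alpha)$. The quotient of $X$ by an equivalence relation $R\subseteq X\times X$ is $Q_R=\{t:\exists x\in X.\ t=C(x)\}$ with $C(x)=\{y\in X:\langle x,y\rangle\in R\}$, and the quotient map $X\to Q_R$ is $x\mapsto C(x)$; $Q_\mu(X)$ denotes $Q_{R_\mu(X)}$ and $q_\mu^X$ its quotient map. *)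

theory Defs
  imports Main
begin

section \<open>Categories, functors, finite products\<close>

record ('o, 'a) category_data =
  Obj :: "'o set"
  Arr :: "'a set"
  Dom :: "'a \<Rightarrow> 'o"
  Cod :: "'a \<Rightarrow> 'o"
  Ide :: "'o \<Rightarrow> 'a"
  Comp :: "'a \<Rightarrow> 'a \<Rightarrow> 'a"  (infixr "\<cdot>\<index>" 70)

text \<open>Composition is written in applicative order: \<open>g \<cdot>\<^bsub>E\<^esub> f\<close> is ``first f, then g''.\<close>

definition hom :: "('o, 'a, 'm) category_data_scheme \<Rightarrow> 'o \<Rightarrow> 'o \<Rightarrow> 'a set" where
  "hom E A B = {f \<in> Arr E. Dom E f = A \<and> Cod E f = B}"

locale category =
  fixes E :: "('o, 'a, 'm) category_data_scheme" (structure)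
  assumes Dom_Obj: "f \<in> Arr E \<Longrightarrow> Dom E f \<in> Obj E"
    and Cod_Obj: "f \<in> Arr E \<Longrightarrow> Cod E f \<in> Obj E"
    and Ide_hom: "A \<in> Obj E \<Longrightarrow> Ide E A \<in> hom E A A"
    and Comp_hom: "\<lbrakk>f \<in> hom E A B; g \<in> hom E B C\<rbrakk> \<Longrightarrow> g \<cdot> f \<in> hom E A C"
    and Ide_left: "f \<in> hom E A B \<Longrightarrow> Ide E B \<cdot> f = f"
    and Ide_right: "f \<in> hom E A B \<Longrightarrow> f \<cdot> Ide E A = f"
    and Comp_assoc: "\<lbrakk>f \<in> hom E A B; g \<in> hom E B C; h \<in> hom E C D\<rbrakk>
                       \<Longrightarrow> (h \<cdot> g) \<cdot> f = h \<cdot> (g \<cdot> f)"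

definition is_terminal :: "('o, 'a, 'm) category_data_scheme \<Rightarrow> 'o \<Rightarrow> bool" where
  "is_terminal E T \<longleftrightarrow> T \<in> Obj E \<and> (\<forall>A \<in> Obj E. \<exists>!f. f \<in> hom E A T)"

definition is_product ::
  "('o, 'a, 'm) category_data_scheme \<Rightarrow> 'o \<Rightarrow> 'a \<Rightarrow> 'a \<Rightarrow> 'o \<Rightarrow> 'o \<Rightarrow> bool" where
  "is_product E P p q A B \<longleftrightarrow> p \<in> hom E P A \<and> q \<in> hom E P B \<and>
     (\<forall>T f g. f \<in> hom E T A \<longrightarrow> g \<in> hom E T B \<longrightarrow>
        (\<exists>!h. h \<in> hom E T P \<and> p \<cdot>\<^bsub>E\<^esub> h = f \<and> q \<cdot>\<^bsub>E\<^esub> h = g))"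

definition is_pullback ::
  "('o, 'a, 'm) category_data_scheme \<Rightarrow> 'a \<Rightarrow> 'a \<Rightarrow> 'a \<Rightarrow> 'a \<Rightarrow> bool" where
  "is_pullback E f g p q \<longleftrightarrow>
     f \<in> Arr E \<and> g \<in> Arr E \<and> Cod E f = Cod E g \<and>
     p \<in> hom E (Dom E p) (Dom E f) \<and> q \<in> hom E (Dom E p) (Dom E g) \<and>
     f \<cdot>\<^bsub>E\<^esub> p = g \<cdot>\<^bsub>E\<^esub> q \<and>
     (\<forall>T u v. u \<in> hom E T (Dom E f) \<longrightarrow> v \<in> hom E T (Dom E g) \<longrightarrow> f \<cdot>\<^bsub>E\<^esub> u = g \<cdot>\<^bsub>E\<^esub> v \<longrightarrow>
        (\<exists>!h. h \<in> hom E T (Dom E p) \<and> p \<cdot>\<^bsub>E\<^esub> h = u \<and> q \<cdot>\<^bsub>E\<^esub> h = v))"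

definition is_monic :: "('o, 'a, 'm) category_data_scheme \<Rightarrow> 'a \<Rightarrow> bool" where
  "is_monic E m \<longleftrightarrow> m \<in> Arr E \<and>
     (\<forall>T u v. u \<in> hom E T (Dom E m) \<longrightarrow> v \<in> hom E T (Dom E m) \<longrightarrow>
        m \<cdot>\<^bsub>E\<^esub> u = m \<cdot>\<^bsub>E\<^esub> v \<longrightarrow> u = v)"

record ('o, 'a, 'p, 'b) functor_data =
  FObj :: "'o \<Rightarrow> 'p"
  FArr :: "'a \<Rightarrow> 'b"

definition is_functor ::
  "('o, 'a, 'm) category_data_scheme \<Rightarrow> ('p, 'b, 'n) category_data_scheme \<Rightarrow>
   ('o, 'a, 'p, 'b) functor_data \<Rightarrow> bool" where
  "is_functor C D F \<longleftrightarrow>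
     (\<forall>A \<in> Obj C. FObj F A \<in> Obj D) \<and>
     (\<forall>A B f. f \<in> hom C A B \<longrightarrow> FArr F f \<in> hom D (FObj F A) (FObj F B)) \<and>
     (\<forall>A \<in> Obj C. FArr F (Ide C A) = Ide D (FObj F A)) \<and>
     (\<forall>A B X f g. f \<in> hom C A B \<longrightarrow> g \<in> hom C B X \<longrightarrow>
        FArr F (g \<cdot>\<^bsub>C\<^esub> f) = FArr F g \<cdot>\<^bsub>D\<^esub> FArr F f)"

definition identity_functor :: "('o, 'a, 'o, 'a) functor_data" where
  "identity_functor = \<lparr>FObj = (\<lambda>A. A), FArr = (\<lambda>f. f)\<rparr>"

definition natural_transformation ::
  "('o, 'a, 'm) category_data_scheme \<Rightarrow> ('p, 'b, 'n) category_data_scheme \<Rightarrow>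
   ('o, 'a, 'p, 'b) functor_data \<Rightarrow> ('o, 'a, 'p, 'b) functor_data \<Rightarrow> ('o \<Rightarrow> 'b) \<Rightarrow> bool" where
  "natural_transformation C D F G \<eta> \<longleftrightarrow>
     (\<forall>A \<in> Obj C. \<eta> A \<in> hom D (FObj F A) (FObj G A)) \<and>
     (\<forall>A B f. f \<in> hom C A B \<longrightarrow> \<eta> B \<cdot>\<^bsub>D\<^esub> FArr F f = FArr G f \<cdot>\<^bsub>D\<^esub> \<eta> A)"

definition preserves_finite_products ::
  "('o, 'a, 'm) category_data_scheme \<Rightarrow> ('p, 'b, 'n) category_data_scheme \<Rightarrow>
   ('o, 'a, 'p, 'b) functor_data \<Rightarrow> bool" where
  "preserves_finite_products C D F \<longleftrightarrow>
     (\<forall>T. is_terminal C T \<longrightarrow> is_terminal D (FObj F T)) \<and>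
     (\<forall>P p q A B. is_product C P p q A B \<longrightarrow>
        is_product D (FObj F P) (FArr F p) (FArr F q) (FObj F A) (FObj F B))"


section \<open>Toposes\<close>

text \<open>
  An elementary topos is a category with a terminal object, pullbacks (hence binary products),
  a subobject classifier and power objects.  The record carries an arbitrary choice of this
  structure, which is needed to interpret the internal language.  \<open>Pb1 E f g\<close> and \<open>Pb2 E f g\<close>
  are the projections of the chosen pullback of f and g, and \<open>Elt E A\<close> is the
  membership arrow \<open>A \<times> P A \<rightarrow> \<Omega>\<close>.
\<close>

record ('o, 'a) topos_data = "('o, 'a) category_data" +
  One :: 'o
  ProdObj :: "'o \<Rightarrow> 'o \<Rightarrow> 'o"
  Pr1 :: "'o \<Rightarrow> 'o \<Rightarrow> 'a"
  Pr2 :: "'o \<Rightarrow> 'o \<Rightarrow> 'a"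
  Pb1 :: "'a \<Rightarrow> 'a \<Rightarrow> 'a"
  Pb2 :: "'a \<Rightarrow> 'a \<Rightarrow> 'a"
  Om :: 'o
  Tru :: 'a
  PowObj :: "'o \<Rightarrow> 'o"
  Elt :: "'o \<Rightarrow> 'a"

definition bang :: "('o, 'a) topos_data \<Rightarrow> 'o \<Rightarrow> 'a" where
  "bang E A = (THE f. f \<in> hom E A (One E))"

definition pairing :: "('o, 'a) topos_data \<Rightarrow> 'a \<Rightarrow> 'a \<Rightarrow> 'a" where
  "pairing E f g = (THE h. h \<in> hom E (Dom E f) (ProdObj E (Cod E f) (Cod E g)) \<and>
     Pr1 E (Cod E f) (Cod E g) \<cdot>\<^bsub>E\<^esub> h = f \<and> Pr2 E (Cod E f) (Cod E g) \<cdot>\<^bsub>E\<^esub> h = g)"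

definition is_transpose :: "('o, 'a) topos_data \<Rightarrow> 'o \<Rightarrow> 'o \<Rightarrow> 'a \<Rightarrow> 'a \<Rightarrow> bool" where
  "is_transpose E A B f g \<longleftrightarrow> g \<in> hom E B (PowObj E A) \<and>
     Elt E A \<cdot>\<^bsub>E\<^esub> pairing E (Pr1 E A B) (g \<cdot>\<^bsub>E\<^esub> Pr2 E A B) = f"

locale topos = category E for E :: "('o, 'a) topos_data" (structure) +
  assumes One_terminal: "is_terminal E (One E)"
    and Prod_product: "\<lbrakk>A \<in> Obj E; B \<in> Obj E\<rbrakk>
          \<Longrightarrow> is_product E (ProdObj E A B) (Pr1 E A B) (Pr2 E A B) A B"
    and Pb_pullback: "\<lbrakk>f \<in> hom E A C; g \<in> hom E B C\<rbrakk>
          \<Longrightarrow> is_pullback E f g (Pb1 E f g) (Pb2 E f g)"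
    and Tru_hom: "Tru E \<in> hom E (One E) (Om E)"
    and classifier: "is_monic E m
          \<Longrightarrow> \<exists>!\<chi>. \<chi> \<in> hom E (Cod E m) (Om E) \<and> is_pullback E \<chi> (Tru E) m (bang E (Dom E m))"
    and Elt_hom: "A \<in> Obj E \<Longrightarrow> Elt E A \<in> hom E (ProdObj E A (PowObj E A)) (Om E)"
    and power: "\<lbrakk>A \<in> Obj E; B \<in> Obj E; f \<in> hom E (ProdObj E A B) (Om E)\<rbrakk>
          \<Longrightarrow> \<exists>!g. is_transpose E A B f g"

definition transpose_arr :: "('o, 'a) topos_data \<Rightarrow> 'o \<Rightarrow> 'o \<Rightarrow> 'a \<Rightarrow> 'a" where
  "transpose_arr E A B f = (THE g. is_transpose E A B f g)"

definition true_on :: "('o, 'a) topos_data \<Rightarrow> 'o \<Rightarrow> 'a" where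
  "true_on E A = Tru E \<cdot>\<^bsub>E\<^esub> bang E A"

text \<open>The equality predicate \<open>A \<times> A \<rightarrow> \<Omega>\<close>: the character of the diagonal.\<close>

definition eq_arr :: "('o, 'a) topos_data \<Rightarrow> 'o \<Rightarrow> 'a" where
  "eq_arr E A = (THE \<chi>. \<chi> \<in> hom E (ProdObj E A A) (Om E) \<and>
     is_pullback E \<chi> (Tru E) (pairing E (Ide E A) (Ide E A)) (bang E A))"


section \<open>The internal language of a topos\<close>

text \<open>
  Types are the objects of the topos, function symbols are its arrows, and variables are
  natural numbers whose types are recorded in a context.  Projections of a pair are
  applications of the arrows \<open>Pr1\<close> and \<open>Pr2\<close>.  \<open>SetOf x A \<alpha>\<close> is \<open>{x \<in> A. \<alpha>}\<close>, of type \<open>P A\<close>,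
  and binds x.
\<close>

datatype ('o, 'a) tm =
    Var nat
  | Star
  | App 'a "('o, 'a) tm"
  | PairT "('o, 'a) tm" "('o, 'a) tm"
  | SetOf nat 'o "('o, 'a) tm"
  | Eq "('o, 'a) tm" "('o, 'a) tm"
  | Mem "('o, 'a) tm" "('o, 'a) tm"

type_synonym 'o ctx = "(nat \<times> 'o) list"

definition wf_ctx :: "('o, 'a) topos_data \<Rightarrow> 'o ctx \<Rightarrow> bool" where
  "wf_ctx E G \<longleftrightarrow> snd ` set G \<subseteq> Obj E"

inductive has_type :: "('o, 'a) topos_data \<Rightarrow> 'o ctx \<Rightarrow> ('o, 'a) tm \<Rightarrow> 'o \<Rightarrow> bool"
  for E :: "('o, 'a) topos_data" where
  "map_of G x = Some A \<Longrightarrow> has_type E G (Var x) A"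
| "has_type E G Star (One E)"
| "\<lbrakk>f \<in> hom E A B; has_type E G t A\<rbrakk> \<Longrightarrow> has_type E G (App f t) B"
| "\<lbrakk>has_type E G s A; has_type E G t B\<rbrakk> \<Longrightarrow> has_type E G (PairT s t) (ProdObj E A B)"
| "\<lbrakk>A \<in> Obj E; has_type E ((x, A) # G) \<alpha> (Om E)\<rbrakk> \<Longrightarrow> has_type E G (SetOf x A \<alpha>) (PowObj E A)"
| "\<lbrakk>has_type E G s A; has_type E G t A\<rbrakk> \<Longrightarrow> has_type E G (Eq s t) (Om E)"
| "\<lbrakk>has_type E G s A; has_type E G t (PowObj E A)\<rbrakk> \<Longrightarrow> has_type E G (Mem s t) (Om E)"

text \<open>
  A context is interpreted as the product of its types, and a term of type B in the context G
  as an arrow from \<open>ctx_obj E G\<close> to B.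
\<close>

fun ctx_obj :: "('o, 'a) topos_data \<Rightarrow> 'o ctx \<Rightarrow> 'o" where
  "ctx_obj E [] = One E"
| "ctx_obj E ((x, A) # G) = ProdObj E A (ctx_obj E G)"

fun var_arr :: "('o, 'a) topos_data \<Rightarrow> 'o ctx \<Rightarrow> nat \<Rightarrow> 'a" where
  "var_arr E [] x = undefined"
| "var_arr E ((y, A) # G) x =
     (if x = y then Pr1 E A (ctx_obj E G) else var_arr E G x \<cdot>\<^bsub>E\<^esub> Pr2 E A (ctx_obj E G))"

fun sem :: "('o, 'a) topos_data \<Rightarrow> 'o ctx \<Rightarrow> ('o, 'a) tm \<Rightarrow> 'a" where
  "sem E G (Var x) = var_arr E G x"
| "sem E G Star = bang E (ctx_obj E G)"
| "sem E G (App f t) = f \<cdot>\<^bsub>E\<^esub> sem E G t"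
| "sem E G (PairT s t) = pairing E (sem E G s) (sem E G t)"
| "sem E G (SetOf x A \<alpha>) = transpose_arr E A (ctx_obj E G) (sem E ((x, A) # G) \<alpha>)"
| "sem E G (Eq s t) = eq_arr E (Cod E (sem E G s)) \<cdot>\<^bsub>E\<^esub> pairing E (sem E G s) (sem E G t)"
| "sem E G (Mem s t) = Elt E (Cod E (sem E G s)) \<cdot>\<^bsub>E\<^esub> pairing E (sem E G s) (sem E G t)"

text \<open>
  \<open>\<alpha> \<turnstile> \<beta>\<close> in the internal theory: the subobject of the context classified by \<open>\<alpha>\<close> is contained in
  the one classified by \<open>\<beta>\<close>, expressed through generalized elements t of the context.
\<close>

definition entails ::
  "('o, 'a) topos_data \<Rightarrow> 'o ctx \<Rightarrow> ('o, 'a) tm \<Rightarrow> ('o, 'a) tm \<Rightarrow> bool" where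
  "entails E G \<alpha> \<beta> \<longleftrightarrow> (\<forall>T t. t \<in> hom E T (ctx_obj E G) \<longrightarrow>
     sem E G \<alpha> \<cdot>\<^bsub>E\<^esub> t = true_on E T \<longrightarrow> sem E G \<beta> \<cdot>\<^bsub>E\<^esub> t = true_on E T)"

definition holds :: "('o, 'a) topos_data \<Rightarrow> ('o, 'a) tm \<Rightarrow> bool" where
  "holds E \<phi> \<longleftrightarrow> has_type E [] \<phi> (Om E) \<and> sem E [] \<phi> = true_on E (One E)"

text \<open>
  The logical operations are the usual abbreviations of a local set theory, e.g.
  \<open>\<exists>x. \<alpha>\<close> is \<open>\<forall>w. (\<forall>x. \<alpha> \<Rightarrow> w) \<Rightarrow> w\<close> with w a fresh variable of type \<open>\<Omega>\<close>.
  \<open>fresh t\<close> exceeds all variables, free or bound, of t.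
\<close>

fun fresh :: "('o, 'a) tm \<Rightarrow> nat" where
  "fresh (Var x) = Suc x"
| "fresh Star = 0"
| "fresh (App f t) = fresh t"
| "fresh (PairT s t) = max (fresh s) (fresh t)"
| "fresh (SetOf x A \<alpha>) = max (Suc x) (fresh \<alpha>)"
| "fresh (Eq s t) = max (fresh s) (fresh t)"
| "fresh (Mem s t) = max (fresh s) (fresh t)"

definition TT :: "('o, 'a) tm" where
  "TT = Eq Star Star"

definition And :: "('o, 'a) tm \<Rightarrow> ('o, 'a) tm \<Rightarrow> ('o, 'a) tm" where
  "And \<alpha> \<beta> = Eq (PairT \<alpha> \<beta>) (PairT TT TT)"

definition Imp :: "('o, 'a) tm \<Rightarrow> ('o, 'a) tm \<Rightarrow> ('o, 'a) tm" where
  "Imp \<alpha> \<beta> = Eq (And \<alpha> \<beta>) \<alpha>"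

definition Forall :: "nat \<Rightarrow> 'o \<Rightarrow> ('o, 'a) tm \<Rightarrow> ('o, 'a) tm" where
  "Forall x A \<alpha> = Eq (SetOf x A \<alpha>) (SetOf x A TT)"

definition Exists :: "('o, 'a) topos_data \<Rightarrow> nat \<Rightarrow> 'o \<Rightarrow> ('o, 'a) tm \<Rightarrow> ('o, 'a) tm" where
  "Exists E x A \<alpha> = (let w = max (Suc x) (fresh \<alpha>)
     in Forall w (Om E) (Imp (Forall x A (Imp \<alpha> (Var w))) (Var w)))"

text \<open>\<open>{\<langle>x, y\<rangle> \<in> A \<times> B. \<alpha>}\<close>, i.e. \<open>{z \<in> A \<times> B. \<exists>x \<in> A. \<exists>y \<in> B. z = \<langle>x, y\<rangle> \<and> \<alpha>}\<close> with z fresh.\<close>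

definition SetOfPairs ::
  "('o, 'a) topos_data \<Rightarrow> nat \<Rightarrow> 'o \<Rightarrow> nat \<Rightarrow> 'o \<Rightarrow> ('o, 'a) tm \<Rightarrow> ('o, 'a) tm" where
  "SetOfPairs E x A y B \<alpha> = (let z = max (max (Suc x) (Suc y)) (fresh \<alpha>)
     in SetOf z (ProdObj E A B)
          (Exists E x A (Exists E y B (And (Eq (Var z) (PairT (Var x) (Var y))) \<alpha>))))"


section \<open>Equivalence relations and quotients\<close>

text \<open>Subsets of an object X are closed terms of type \<open>P X\<close>; relations on X are closed terms
  of type \<open>P (X \<times> X)\<close>.\<close>

definition equivalence_relation :: "('o, 'a) topos_data \<Rightarrow> 'o \<Rightarrow> ('o, 'a) tm \<Rightarrow> bool" where
  "equivalence_relation E X R \<longleftrightarrow>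
     has_type E [] R (PowObj E (ProdObj E X X)) \<and>
     holds E (Forall 0 X (Mem (PairT (Var 0) (Var 0)) R)) \<and>
     holds E (Forall 0 X (Forall 1 X
       (Imp (Mem (PairT (Var 0) (Var 1)) R) (Mem (PairT (Var 1) (Var 0)) R)))) \<and>
     holds E (Forall 0 X (Forall 1 X (Forall 2 X
       (Imp (And (Mem (PairT (Var 0) (Var 1)) R) (Mem (PairT (Var 1) (Var 2)) R))
            (Mem (PairT (Var 0) (Var 2)) R)))))"

text \<open>The arrow \<open>x \<mapsto> t\<close> out of A determined by a term t with no free variable besides x of type A;
  the arrow from A to its product with the terminal object adjusts for \<open>ctx_obj E [(x, A)]\<close>.\<close>

definition arrow_of :: "('o, 'a) topos_data \<Rightarrow> nat \<Rightarrow> 'o \<Rightarrow> ('o, 'a) tm \<Rightarrow> 'a" where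
  "arrow_of E x A t = sem E [(x, A)] t \<cdot>\<^bsub>E\<^esub> pairing E (Ide E A) (bang E A)"

text \<open>The inclusion into A of the object of E given by a closed term S of type \<open>P A\<close>.\<close>

definition inclusion :: "('o, 'a) topos_data \<Rightarrow> 'o \<Rightarrow> ('o, 'a) tm \<Rightarrow> 'a" where
  "inclusion E A S = Pb1 E (arrow_of E 0 A (Mem (Var 0) S)) (Tru E)"

text \<open>\<open>C(x) = {y \<in> X. \<langle>x, y\<rangle> \<in> R}\<close>, a term in the free variable 0.\<close>

definition eq_class :: "'o \<Rightarrow> ('o, 'a) tm \<Rightarrow> ('o, 'a) tm" where
  "eq_class X R = SetOf 1 X (Mem (PairT (Var 0) (Var 1)) R)"

definition quotient_set :: "('o, 'a) topos_data \<Rightarrow> 'o \<Rightarrow> ('o, 'a) tm \<Rightarrow> ('o, 'a) tm" where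
  "quotient_set E X R = SetOf 2 (PowObj E X) (Exists E 0 X (Eq (Var 2) (eq_class X R)))"

definition quotient_incl :: "('o, 'a) topos_data \<Rightarrow> 'o \<Rightarrow> ('o, 'a) tm \<Rightarrow> 'a" where
  "quotient_incl E X R = inclusion E (PowObj E X) (quotient_set E X R)"

definition quotient_obj :: "('o, 'a) topos_data \<Rightarrow> 'o \<Rightarrow> ('o, 'a) tm \<Rightarrow> 'o" where
  "quotient_obj E X R = Dom E (quotient_incl E X R)"

definition is_quotient_map :: "('o, 'a) topos_data \<Rightarrow> 'o \<Rightarrow> ('o, 'a) tm \<Rightarrow> 'a \<Rightarrow> bool" where
  "is_quotient_map E X R q \<longleftrightarrow> q \<in> hom E X (quotient_obj E X R) \<and>
     quotient_incl E X R \<cdot>\<^bsub>E\<^esub> q = arrow_of E 0 X (eq_class X R)"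

definition quotient_map :: "('o, 'a) topos_data \<Rightarrow> 'o \<Rightarrow> ('o, 'a) tm \<Rightarrow> 'a" where
  "quotient_map E X R = (THE q. is_quotient_map E X R q)"


section \<open>Modalities\<close>

text \<open>
  A modality is a formula in one free variable of type \<open>\<Omega>\<close>, with \<open>\<mu>(\<alpha>)\<close> obtained by substituting
  \<open>\<alpha>\<close> for that variable.  In the internal language of a topos such a formula is an arrow
  \<open>\<Omega> \<rightarrow> \<Omega>\<close>, and \<open>\<mu>(\<alpha>)\<close> is its application to \<open>\<alpha>\<close>.
\<close>

definition modality :: "('o, 'a) topos_data \<Rightarrow> 'a \<Rightarrow> bool" where
  "modality E \<mu> \<longleftrightarrow> \<mu> \<in> hom E (Om E) (Om E) \<and>
     (\<forall>G \<alpha>. wf_ctx E G \<longrightarrow> has_type E G \<alpha> (Om E) \<longrightarrow> entails E G \<alpha> (App \<mu> \<alpha>)) \<and>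
     (\<forall>G \<alpha> \<beta>. wf_ctx E G \<longrightarrow> has_type E G \<alpha> (Om E) \<longrightarrow> has_type E G \<beta> (Om E) \<longrightarrow>
        entails E G \<alpha> \<beta> \<longrightarrow> entails E G (App \<mu> \<alpha>) (App \<mu> \<beta>)) \<and>
     (\<forall>G \<alpha>. wf_ctx E G \<longrightarrow> has_type E G \<alpha> (Om E) \<longrightarrow>
        entails E G (App \<mu> (App \<mu> \<alpha>)) (App \<mu> \<alpha>))"

definition modal_rel :: "('o, 'a) topos_data \<Rightarrow> 'a \<Rightarrow> 'o \<Rightarrow> ('o, 'a) tm" where
  "modal_rel E \<mu> X = SetOfPairs E 0 X 1 X (App \<mu> (Eq (Var 0) (Var 1)))"

definition modal_quotient :: "('o, 'a) topos_data \<Rightarrow> 'a \<Rightarrow> 'o \<Rightarrow> 'o" where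
  "modal_quotient E \<mu> X = quotient_obj E X (modal_rel E \<mu> X)"

definition modal_quotient_map :: "('o, 'a) topos_data \<Rightarrow> 'a \<Rightarrow> 'o \<Rightarrow> 'a" where
  "modal_quotient_map E \<mu> X = quotient_map E X (modal_rel E \<mu> X)"

end

theory Submission
  imports Defs
begin

text \<open>
  On generalized elements \<open>x, y : T \<rightarrow> X\<close>, put \<open>x \<sim> y\<close> iff \<open>\<mu>(x = y)\<close> is true on \<open>T\<close>.  Kripke--Joyal
  semantics identifies \<open>R\<^sub>\<mu>(X)\<close> with \<open>\<sim>\<close>.  Everything about \<open>\<sim>\<close> follows from one principle: if \<open>x \<sim> y\<close>
  and \<open>b\<close> is true wherever \<open>x\<close> and \<open>y\<close> agree, then \<open>\<mu>(b)\<close> is true; transitivity is the case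
  \<open>b = \<mu>(x = z)\<close> together with idempotence.  The quotient map \<open>q\<close> is locally surjective with kernel \<open>\<sim>\<close>,
  so arrows respecting \<open>\<sim>\<close> descend along it, and two elements of a product that are \<open>\<sim>\<close>-related in each
  component are related.  Hence \<open>Q(A \<times> B) \<rightarrow> Q(A) \<times> Q(B)\<close> is monic and locally surjective, and therefore
  invertible.
\<close>

text \<open>The existential quantifier of the language is encoded through a variable truth value, so
  the forcing clause of \<open>Exists\<close> hands over no witness, not even after a change of
  stage; it only lets a truth value \<open>\<omega>\<close> be established from hypothetical
  witnesses. Hence \<open>cover\<close> is an elimination rule into \<open>Om E\<close>, an equation
  of arrows is proved by taking \<open>\<omega>\<close> to be its truth value, and an image is the
  subobject classified by the interpretation of an internal formula. Arrows out of a quotient are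
  not defined by choosing representatives: they come from a graph whose projection to the quotient
  is monic and a cover, hence split.

  The axioms of a modality do not list compatibility with conjunction, whereas monotonicity
  transports a single equation under \<open>\<mu>\<close>. Nearness in a product is therefore
  obtained in two moves, one for each component, glued by transitivity.\<close>

context topos
begin

section \<open>Generalized elements of a topos\<close>

text \<open>Carrying the two object conditions along makes a single unfolding turn typing goals into
  domain, codomain and object conditions, which the conditional simplification rules below can
  decide.\<close>

lemma hom_iff:
  "f \<in> hom E A B \<longleftrightarrow> f \<in> Arr E \<and> Dom E f = A \<and> Cod E f = B \<and> A \<in> Obj E \<and> B \<in> Obj E"
  using Dom_Obj Cod_Obj by (auto simp: hom_def)

lemma comp_simps [simp]:
  assumes "f \<in> Arr E" "g \<in> Arr E" "Cod E f = Dom E g"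
  shows "g \<cdot> f \<in> Arr E" "Dom E (g \<cdot> f) = Dom E f" "Cod E (g \<cdot> f) = Cod E g"
  using Comp_hom[of f "Dom E f" "Cod E f" g "Cod E g"] assms by (auto simp: hom_def)

lemma comp_assoc [simp]:
  "\<lbrakk>f \<in> Arr E; g \<in> Arr E; h \<in> Arr E; Cod E f = Dom E g; Cod E g = Dom E h\<rbrakk>
    \<Longrightarrow> (h \<cdot> g) \<cdot> f = h \<cdot> (g \<cdot> f)"
  using Comp_assoc[of f "Dom E f" "Cod E f" g "Cod E g" h "Cod E h"] by (simp add: hom_def)

lemma Ide_simps [simp]:
  assumes "A \<in> Obj E"
  shows "Ide E A \<in> Arr E" "Dom E (Ide E A) = A" "Cod E (Ide E A) = A"
  using Ide_hom[OF assms] by (auto simp: hom_def)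

lemma Ide_comp [simp]:
  "f \<in> Arr E \<Longrightarrow> Cod E f = A \<Longrightarrow> Ide E A \<cdot> f = f"
  "f \<in> Arr E \<Longrightarrow> Dom E f = A \<Longrightarrow> f \<cdot> Ide E A = f"
  using Ide_left Ide_right by (auto simp: hom_def)

lemma One_Obj [simp]: "One E \<in> Obj E"
  using One_terminal by (simp add: is_terminal_def)

lemma bang_hom: "A \<in> Obj E \<Longrightarrow> bang E A \<in> hom E A (One E)"
  unfolding bang_def by (rule theI') (use One_terminal in \<open>simp add: is_terminal_def\<close>)

lemma bang_unique: "f \<in> hom E A (One E) \<Longrightarrow> f = bang E A"
  using One_terminal bang_hom by (auto simp: is_terminal_def hom_iff)

lemma bang_simps [simp]:
  assumes "A \<in> Obj E"
  shows "bang E A \<in> Arr E" "Dom E (bang E A) = A" "Cod E (bang E A) = One E"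
  using bang_hom[OF assms] by (auto simp: hom_def)

lemma bang_comp [simp]: "f \<in> Arr E \<Longrightarrow> Cod E f = A \<Longrightarrow> bang E A \<cdot> f = bang E (Dom E f)"
  by (rule bang_unique) (auto simp: hom_iff Dom_Obj Cod_Obj)

lemma Tru_simps [simp]: "Tru E \<in> Arr E" "Dom E (Tru E) = One E" "Cod E (Tru E) = Om E"
  using Tru_hom by (auto simp: hom_def)

lemma Om_Obj [simp]: "Om E \<in> Obj E"
  using Tru_hom by (simp add: hom_iff)

lemma true_on_simps [simp]:
  assumes "A \<in> Obj E"
  shows "true_on E A \<in> Arr E" "Dom E (true_on E A) = A" "Cod E (true_on E A) = Om E"
  using assms by (auto simp: true_on_def)

lemma true_on_comp [simp]:
  "f \<in> Arr E \<Longrightarrow> Cod E f = A \<Longrightarrow> true_on E A \<cdot> f = true_on E (Dom E f)"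
  using Cod_Obj by (auto simp: true_on_def)

lemma Prod_simps [simp]:
  assumes "A \<in> Obj E" "B \<in> Obj E"
  shows "ProdObj E A B \<in> Obj E" "Pr1 E A B \<in> Arr E" "Pr2 E A B \<in> Arr E"
    "Dom E (Pr1 E A B) = ProdObj E A B" "Dom E (Pr2 E A B) = ProdObj E A B"
    "Cod E (Pr1 E A B) = A" "Cod E (Pr2 E A B) = B"
  using Prod_product[OF assms] by (auto simp: is_product_def hom_iff)

lemma pairing_ex1:
  assumes "f \<in> hom E T A" "g \<in> hom E T B"
  shows "\<exists>!h. h \<in> hom E T (ProdObj E A B) \<and> Pr1 E A B \<cdot> h = f \<and> Pr2 E A B \<cdot> h = g"
proof -
  have "A \<in> Obj E" "B \<in> Obj E" using assms by (auto simp: hom_iff)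
  from Prod_product[OF this] assms show ?thesis unfolding is_product_def by blast
qed

lemma pairing_spec:
  assumes "f \<in> Arr E" "g \<in> Arr E" "Dom E f = Dom E g"
  shows "pairing E f g \<in> hom E (Dom E f) (ProdObj E (Cod E f) (Cod E g)) \<and>
     Pr1 E (Cod E f) (Cod E g) \<cdot> pairing E f g = f \<and> Pr2 E (Cod E f) (Cod E g) \<cdot> pairing E f g = g"
  unfolding pairing_def
  by (rule theI', rule pairing_ex1) (use assms in \<open>auto simp: hom_def\<close>)

lemma pairing_simps [simp]:
  assumes "f \<in> Arr E" "g \<in> Arr E" "Dom E f = Dom E g"
  shows "pairing E f g \<in> Arr E" "Dom E (pairing E f g) = Dom E g"
    "Cod E (pairing E f g) = ProdObj E (Cod E f) (Cod E g)"
    "Cod E f = A \<Longrightarrow> Cod E g = B \<Longrightarrow> Pr1 E A B \<cdot> pairing E f g = f"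
    "Cod E f = A \<Longrightarrow> Cod E g = B \<Longrightarrow> Pr2 E A B \<cdot> pairing E f g = g"
  using pairing_spec[OF assms] assms by (auto simp: hom_def)

lemma Prod_ext:
  assumes "h \<in> hom E T (ProdObj E A B)" "h' \<in> hom E T (ProdObj E A B)" "A \<in> Obj E" "B \<in> Obj E"
    and "Pr1 E A B \<cdot> h = Pr1 E A B \<cdot> h'" "Pr2 E A B \<cdot> h = Pr2 E A B \<cdot> h'"
  shows "h = h'"
proof -
  have "Pr1 E A B \<cdot> h' \<in> hom E T A" "Pr2 E A B \<cdot> h' \<in> hom E T B"
    using assms by (auto simp: hom_iff)
  from pairing_ex1[OF this] assms show ?thesis by blast
qed

lemma pairing_comp [simp]:
  assumes "f \<in> Arr E" "g \<in> Arr E" "Dom E f = Dom E g" "h \<in> Arr E" "Cod E h = Dom E g"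
  shows "pairing E f g \<cdot> h = pairing E (f \<cdot> h) (g \<cdot> h)"
proof (rule Prod_ext)
  show o: "Cod E f \<in> Obj E" "Cod E g \<in> Obj E" using assms Cod_Obj by auto
  have [simp]: "ProdObj E (Cod E f) (Cod E g) \<in> Obj E" "Dom E h \<in> Obj E" using o assms Dom_Obj by auto
  show "pairing E f g \<cdot> h \<in> hom E (Dom E h) (ProdObj E (Cod E f) (Cod E g))"
    "pairing E (f \<cdot> h) (g \<cdot> h) \<in> hom E (Dom E h) (ProdObj E (Cod E f) (Cod E g))"
    using assms by (auto simp: hom_iff)
  show "Pr1 E (Cod E f) (Cod E g) \<cdot> (pairing E f g \<cdot> h) =
      Pr1 E (Cod E f) (Cod E g) \<cdot> pairing E (f \<cdot> h) (g \<cdot> h)"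
    "Pr2 E (Cod E f) (Cod E g) \<cdot> (pairing E f g \<cdot> h) =
      Pr2 E (Cod E f) (Cod E g) \<cdot> pairing E (f \<cdot> h) (g \<cdot> h)"
    using assms o by (simp_all add: comp_assoc[symmetric] del: comp_assoc)
qed

lemma pairing_eta:
  assumes "h \<in> hom E T (ProdObj E A B)" "A \<in> Obj E" "B \<in> Obj E"
  shows "pairing E (Pr1 E A B \<cdot> h) (Pr2 E A B \<cdot> h) = h"
  by (rule Prod_ext[of _ T A B]) (use assms in \<open>auto simp: hom_iff\<close>)

lemma pairing_inject:
  assumes "f \<in> hom E T A" "g \<in> hom E T B" "f' \<in> hom E T A" "g' \<in> hom E T B"
  shows "pairing E f g = pairing E f' g' \<longleftrightarrow> f = f' \<and> g = g'"
proof
  assume h: "pairing E f g = pairing E f' g'"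
  have "f = Pr1 E A B \<cdot> pairing E f g" "g = Pr2 E A B \<cdot> pairing E f g"
    using assms(1,2) by (simp_all add: hom_iff)
  then show "f = f' \<and> g = g'" unfolding h using assms(3,4) by (simp add: hom_iff)
qed simp

section \<open>Subobjects, truth values and internal equality\<close>

lemma is_pullback_Tru_iff:
  assumes "\<chi> \<in> hom E Z (Om E)" "m \<in> hom E M Z"
  shows "is_pullback E \<chi> (Tru E) m (bang E M) \<longleftrightarrow> \<chi> \<cdot> m = true_on E M \<and>
    (\<forall>T u. u \<in> hom E T Z \<longrightarrow> \<chi> \<cdot> u = true_on E T \<longrightarrow> (\<exists>!h. h \<in> hom E T M \<and> m \<cdot> h = u))"
proof -
  \<comment> \<open>Arrows into the terminal object carry no information, so the second leg of every
    cone over \<open>Tru E\<close> can be eliminated; what remains says that \<open>m\<close>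
    represents the elements at which \<open>\<chi>\<close> is true.\<close>
  have b: "v \<in> hom E T (One E) \<longleftrightarrow> T \<in> Obj E \<and> v = bang E T" for v T
    using bang_hom bang_unique by (auto simp: hom_iff)
  have c: "h \<in> hom E T M \<and> m \<cdot> h = u \<and> bang E M \<cdot> h = bang E T \<longleftrightarrow> h \<in> hom E T M \<and> m \<cdot> h = u" for h T u
    by (auto simp: hom_iff)
  have d: "u \<in> hom E T Z \<Longrightarrow> T \<in> Obj E" for u T by (simp add: hom_iff)
  have e: "Dom E \<chi> = Z" "Dom E m = M" "\<chi> \<in> Arr E" "m \<in> Arr E" "Cod E \<chi> = Om E" "M \<in> Obj E"
    "Z \<in> Obj E" "Cod E m = Z"
    using assms by (auto simp: hom_iff)
  show ?thesis
    unfolding is_pullback_def e(1,2) Tru_simps b true_on_def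
    using e(3,5,6) assms(2) c d by simp
qed

lemma is_monicI:
  assumes "m \<in> hom E M Z"
    and "\<And>T u v. u \<in> hom E T M \<Longrightarrow> v \<in> hom E T M \<Longrightarrow> m \<cdot> u = m \<cdot> v \<Longrightarrow> u = v"
  shows "is_monic E m"
  using assms by (auto simp: is_monic_def hom_iff)

lemma is_monicD:
  "\<lbrakk>is_monic E m; m \<cdot> u = m \<cdot> v; m \<in> hom E M Z; u \<in> hom E T M; v \<in> hom E T M\<rbrakk> \<Longrightarrow> u = v"
  by (auto simp: is_monic_def hom_iff)

text \<open>The second projection of the chosen pullback is forced by terminality to be
  \<open>bang\<close>, which is the shape that \<open>classifier\<close> uses. Monicity is the
  uniqueness half of the universal property.\<close>

lemma classified_subobject:
  assumes "\<chi> \<in> hom E Z (Om E)"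
  defines "m \<equiv> Pb1 E \<chi> (Tru E)"
  shows "m \<in> hom E (Dom E m) Z" "is_monic E m" "is_pullback E \<chi> (Tru E) m (bang E (Dom E m))"
proof -
  have pb: "is_pullback E \<chi> (Tru E) m (Pb2 E \<chi> (Tru E))"
    unfolding m_def by (rule Pb_pullback[OF assms(1) Tru_hom])
  then show h: "m \<in> hom E (Dom E m) Z" using assms(1) by (auto simp: is_pullback_def hom_iff)
  have "Pb2 E \<chi> (Tru E) = bang E (Dom E m)"
    using pb by (intro bang_unique) (auto simp: is_pullback_def)
  with pb show p: "is_pullback E \<chi> (Tru E) m (bang E (Dom E m))" by simp
  from p is_pullback_Tru_iff[OF assms(1) h]
  have t: "\<chi> \<cdot> m = true_on E (Dom E m)" and
    u: "\<And>T u. u \<in> hom E T Z \<Longrightarrow> \<chi> \<cdot> u = true_on E T \<Longrightarrow> (\<exists>!h. h \<in> hom E T (Dom E m) \<and> m \<cdot> h = u)"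
    by blast+
  show "is_monic E m"
  proof (rule is_monicI[OF h])
    fix T x y assume xy: "x \<in> hom E T (Dom E m)" "y \<in> hom E T (Dom E m)" "m \<cdot> x = m \<cdot> y"
    have k: "m \<cdot> x \<in> hom E T Z" using h xy by (auto simp: hom_iff)
    have "\<chi> \<cdot> (m \<cdot> x) = (\<chi> \<cdot> m) \<cdot> x" using h xy assms(1) by (auto simp: hom_iff)
    then have l: "\<chi> \<cdot> (m \<cdot> x) = true_on E T" using h xy t by (auto simp: hom_iff)
    show "x = y" using u[OF k l] xy by metis
  qed
qed

text \<open>A pullback of \<open>Tru E\<close> depends only on the elements at which an arrow is
  true, so both arrows classify the same subobject, and uniqueness of classifying arrows identifies
  them. Thus forcing at all stages determines a truth value.\<close>

lemma Om_ext:
  assumes a: "a \<in> hom E Z (Om E)" and b: "b \<in> hom E Z (Om E)"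
    and ab: "\<And>T t. t \<in> hom E T Z \<Longrightarrow> a \<cdot> t = true_on E T \<longleftrightarrow> b \<cdot> t = true_on E T"
  shows "a = b"
proof -
  let ?m = "Pb1 E a (Tru E)"
  note m = classified_subobject[OF a]
  have Z: "Cod E ?m = Z" using m by (simp add: hom_iff)
  have "is_pullback E b (Tru E) ?m (bang E (Dom E ?m))"
    using m(3) ab m(1) unfolding is_pullback_Tru_iff[OF a m(1)] is_pullback_Tru_iff[OF b m(1)] by metis
  then show ?thesis using classifier[OF m(2)] a b m(3) unfolding Z by blast
qed

lemma eq_arr_spec:
  assumes A: "A \<in> Obj E"
  shows "eq_arr E A \<in> hom E (ProdObj E A A) (Om E) \<and>
     is_pullback E (eq_arr E A) (Tru E) (pairing E (Ide E A) (Ide E A)) (bang E A)"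
proof -
  let ?d = "pairing E (Ide E A) (Ide E A)"
  have d: "?d \<in> hom E A (ProdObj E A A)" using A by (auto simp: hom_iff)
  have "is_monic E ?d"
  proof (rule is_monicI[OF d])
    fix T u v assume uv: "u \<in> hom E T A" "v \<in> hom E T A" "?d \<cdot> u = ?d \<cdot> v"
    then have "Pr1 E A A \<cdot> (?d \<cdot> u) = Pr1 E A A \<cdot> (?d \<cdot> v)" by simp
    then show "u = v" using uv(1,2) A by (auto simp: hom_iff)
  qed
  from classifier[OF this] show ?thesis unfolding eq_arr_def
    by (intro theI'[where P = "\<lambda>\<chi>. \<chi> \<in> hom E (ProdObj E A A) (Om E) \<and>
      is_pullback E \<chi> (Tru E) ?d (bang E A)"]) (use A in simp)
qed

lemma eq_arr_simps [simp]:
  assumes "A \<in> Obj E"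
  shows "eq_arr E A \<in> Arr E" "Dom E (eq_arr E A) = ProdObj E A A" "Cod E (eq_arr E A) = Om E"
  using eq_arr_spec[OF assms] by (auto simp: hom_def)

text \<open>An element of the product factors through the diagonal exactly when its components
  coincide. The connectives are encoded by \<open>Eq\<close>, so their forcing clauses all start
  from this fact.\<close>

lemma eq_arr_true:
  assumes "x \<in> hom E T A" "y \<in> hom E T A"
  shows "eq_arr E A \<cdot> pairing E x y = true_on E T \<longleftrightarrow> x = y"
proof -
  let ?d = "pairing E (Ide E A) (Ide E A)"
  have A: "A \<in> Obj E" using assms by (simp add: hom_iff)
  have d: "?d \<in> hom E A (ProdObj E A A)" using A by (auto simp: hom_iff)
  have "eq_arr E A \<in> hom E (ProdObj E A A) (Om E)" using A by (auto simp: hom_iff)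
  from eq_arr_spec[OF A, THEN conjunct2, unfolded is_pullback_Tru_iff[OF this d]]
  have p1: "eq_arr E A \<cdot> ?d = true_on E A"
    and p2: "\<And>u. u \<in> hom E T (ProdObj E A A) \<Longrightarrow> eq_arr E A \<cdot> u = true_on E T
      \<Longrightarrow> \<exists>h. h \<in> hom E T A \<and> ?d \<cdot> h = u"
    by blast+
  have dx: "?d \<cdot> h = pairing E h h" if "h \<in> hom E T A" for h using that A by (auto simp: hom_iff)
  show ?thesis
  proof
    assume "eq_arr E A \<cdot> pairing E x y = true_on E T"
    moreover have "pairing E x y \<in> hom E T (ProdObj E A A)" using assms by (auto simp: hom_iff)
    ultimately obtain h where h: "h \<in> hom E T A" "?d \<cdot> h = pairing E x y" using p2 by blast
    then have "pairing E h h = pairing E x y" using dx by simp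
    then show "x = y" using pairing_inject[OF h(1) h(1) assms] by auto
  next
    assume "x = y"
    have "(eq_arr E A \<cdot> ?d) \<cdot> x = true_on E T" unfolding p1 using assms by (simp add: hom_iff)
    then show "eq_arr E A \<cdot> pairing E x y = true_on E T"
      using \<open>x = y\<close> assms A by (simp add: hom_iff)
  qed
qed

section \<open>Power objects and comprehension\<close>

lemma Elt_simps [simp]:
  assumes "A \<in> Obj E"
  shows "Elt E A \<in> Arr E" "Dom E (Elt E A) = ProdObj E A (PowObj E A)" "Cod E (Elt E A) = Om E"
  using Elt_hom[OF assms] by (auto simp: hom_def)

lemma transpose_arr_spec:
  assumes "A \<in> Obj E" "B \<in> Obj E" "f \<in> hom E (ProdObj E A B) (Om E)"
  shows "is_transpose E A B f (transpose_arr E A B f)"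
  unfolding transpose_arr_def using power[OF assms] by (rule theI')

lemma transpose_arr_hom:
  assumes "A \<in> Obj E" "B \<in> Obj E" "f \<in> hom E (ProdObj E A B) (Om E)"
  shows "transpose_arr E A B f \<in> hom E B (PowObj E A)"
  using transpose_arr_spec[OF assms] by (simp add: is_transpose_def)

lemma PowObj_Obj [simp]:
  assumes "A \<in> Obj E" shows "PowObj E A \<in> Obj E"
proof -
  have "true_on E (ProdObj E A A) \<in> hom E (ProdObj E A A) (Om E)" using assms by (simp add: hom_iff)
  from transpose_arr_hom[OF assms assms this] show ?thesis by (simp add: hom_iff)
qed

lemma transpose_arr_simps [simp]:
  assumes "A \<in> Obj E" "B \<in> Obj E" "f \<in> Arr E" "Dom E f = ProdObj E A B" "Cod E f = Om E"
  shows "transpose_arr E A B f \<in> Arr E" "Dom E (transpose_arr E A B f) = B"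
    "Cod E (transpose_arr E A B f) = PowObj E A"
  using transpose_arr_hom[of A B f] assms by (auto simp: hom_iff)

text \<open>Beta rule of comprehension: the defining equation of a transpose concerns the generic
  elements of \<open>A\<close> and \<open>B\<close>, and composition with
  \<open>pairing E a b\<close> specializes it.\<close>

lemma Elt_transpose:
  assumes f: "f \<in> hom E (ProdObj E A B) (Om E)" and a: "a \<in> hom E T A" and b: "b \<in> hom E T B"
  shows "Elt E A \<cdot> pairing E a (transpose_arr E A B f \<cdot> b) = f \<cdot> pairing E a b"
proof -
  have o: "A \<in> Obj E" "B \<in> Obj E" using a b by (auto simp: hom_iff)
  have "f \<cdot> pairing E a b =
      (Elt E A \<cdot> pairing E (Pr1 E A B) (transpose_arr E A B f \<cdot> Pr2 E A B)) \<cdot> pairing E a b"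
    using transpose_arr_spec[OF o f] by (simp add: is_transpose_def)
  also have "\<dots> = Elt E A \<cdot> pairing E a (transpose_arr E A B f \<cdot> b)"
    using assms o by (simp add: hom_iff)
  finally show ?thesis by simp
qed

text \<open>Extensionality of power objects. Membership of the generic element is a truth value on
  \<open>ProdObj E A T\<close>, which \<open>Om_ext\<close> recovers from all stages; both arrows
  are then transposes of the same truth value.\<close>

lemma Pow_ext:
  assumes g: "g \<in> hom E T (PowObj E A)" and g': "g' \<in> hom E T (PowObj E A)" and A: "A \<in> Obj E"
    and eq: "\<And>U r a. r \<in> hom E U T \<Longrightarrow> a \<in> hom E U A \<Longrightarrow>
       Elt E A \<cdot> pairing E a (g \<cdot> r) = true_on E U \<longleftrightarrow> Elt E A \<cdot> pairing E a (g' \<cdot> r) = true_on E U"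
  shows "g = g'"
proof -
  let ?f = "\<lambda>g. Elt E A \<cdot> pairing E (Pr1 E A T) (g \<cdot> Pr2 E A T)"
  have T: "T \<in> Obj E" using g by (simp add: hom_iff)
  have h: "?f g \<in> hom E (ProdObj E A T) (Om E)" "?f g' \<in> hom E (ProdObj E A T) (Om E)"
    using g g' A T by (auto simp: hom_iff)
  have "?f g = ?f g'"
  proof (rule Om_ext[OF h])
    fix U t assume t: "t \<in> hom E U (ProdObj E A T)"
    have "Pr2 E A T \<cdot> t \<in> hom E U T" "Pr1 E A T \<cdot> t \<in> hom E U A" using t A T by (auto simp: hom_iff)
    from eq[OF this] show "?f g \<cdot> t = true_on E U \<longleftrightarrow> ?f g' \<cdot> t = true_on E U"
      using t A T g g' by (simp add: hom_iff)
  qed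
  then show ?thesis using power[OF A T h(1)] g g' unfolding is_transpose_def by metis
qed


text \<open>Naturality of transposition in the parameter object: comprehension commutes with
  substitution. This is the binder case of \<open>sem_substitution\<close>.\<close>

lemma transpose_arr_comp:
  assumes f: "f \<in> hom E (ProdObj E A B) (Om E)" and s: "\<sigma> \<in> hom E B' B" and A: "A \<in> Obj E"
  shows "transpose_arr E A B' (f \<cdot> pairing E (Pr1 E A B') (\<sigma> \<cdot> Pr2 E A B')) = transpose_arr E A B f \<cdot> \<sigma>"
    (is "transpose_arr E A B' ?f = _")
proof (rule Pow_ext[OF _ _ A])
  have o: "B \<in> Obj E" "B' \<in> Obj E" using s by (auto simp: hom_iff)
  have f': "?f \<in> hom E (ProdObj E A B') (Om E)" using assms o by (simp add: hom_iff)
  show "transpose_arr E A B' ?f \<in> hom E B' (PowObj E A)" by (rule transpose_arr_hom[OF A o(2) f'])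
  show "transpose_arr E A B f \<cdot> \<sigma> \<in> hom E B' (PowObj E A)" using assms o by (simp add: hom_iff)
  fix U r a assume r: "r \<in> hom E U B'" and a: "a \<in> hom E U A"
  have sr: "\<sigma> \<cdot> r \<in> hom E U B" using s r by (simp add: hom_iff)
  have "Elt E A \<cdot> pairing E a (transpose_arr E A B' ?f \<cdot> r) = f \<cdot> pairing E a (\<sigma> \<cdot> r)"
    unfolding Elt_transpose[OF f' a r] using assms o r a by (simp add: hom_iff)
  also have "\<dots> = Elt E A \<cdot> pairing E a ((transpose_arr E A B f \<cdot> \<sigma>) \<cdot> r)"
    unfolding Elt_transpose[OF f a sr, symmetric] using assms o r by (simp add: hom_iff)
  finally show "Elt E A \<cdot> pairing E a (transpose_arr E A B' ?f \<cdot> r) = true_on E U \<longleftrightarrow>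
      Elt E A \<cdot> pairing E a ((transpose_arr E A B f \<cdot> \<sigma>) \<cdot> r) = true_on E U"
    by simp
qed

text \<open>The two comprehensions may live over different parameter objects, because equivalence
  classes are later compared across different contexts.\<close>

lemma transpose_eq_iff:
  assumes f: "f \<in> hom E (ProdObj E A B) (Om E)" and g: "g \<in> hom E (ProdObj E A B') (Om E)"
    and b: "b \<in> hom E T B" and b': "b' \<in> hom E T B'" and A: "A \<in> Obj E"
  shows "transpose_arr E A B f \<cdot> b = transpose_arr E A B' g \<cdot> b' \<longleftrightarrow>
    (\<forall>U r a. r \<in> hom E U T \<longrightarrow> a \<in> hom E U A \<longrightarrow>
       (f \<cdot> pairing E a (b \<cdot> r) = true_on E U \<longleftrightarrow> g \<cdot> pairing E a (b' \<cdot> r) = true_on E U))"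
    (is "?l = ?r \<longleftrightarrow> ?P")
proof -
  have o: "B \<in> Obj E" "B' \<in> Obj E" using b b' by (auto simp: hom_iff)
  have h: "?l \<in> hom E T (PowObj E A)" "?r \<in> hom E T (PowObj E A)"
    using assms o by (auto simp: hom_iff)
  have e: "Elt E A \<cdot> pairing E a (?l \<cdot> r) = f \<cdot> pairing E a (b \<cdot> r)"
    "Elt E A \<cdot> pairing E a (?r \<cdot> r) = g \<cdot> pairing E a (b' \<cdot> r)"
    if r: "r \<in> hom E U T" and a: "a \<in> hom E U A" for U r a
  proof -
    have br: "b \<cdot> r \<in> hom E U B" "b' \<cdot> r \<in> hom E U B'" using r b b' by (auto simp: hom_iff)
    show "Elt E A \<cdot> pairing E a (?l \<cdot> r) = f \<cdot> pairing E a (b \<cdot> r)"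
      unfolding Elt_transpose[OF f a br(1), symmetric] using assms o r by (simp add: hom_iff)
    show "Elt E A \<cdot> pairing E a (?r \<cdot> r) = g \<cdot> pairing E a (b' \<cdot> r)"
      unfolding Elt_transpose[OF g a br(2), symmetric] using assms o r by (simp add: hom_iff)
  qed
  show ?thesis
  proof
    assume "?l = ?r" then show ?P using e by metis
  next
    assume P: ?P
    show "?l = ?r" by (rule Pow_ext[OF h A]) (use P e in auto)
  qed
qed

section \<open>Kripke--Joyal semantics of the internal language\<close>

lemma wf_ctx_simps [simp]:
  "wf_ctx E []" "wf_ctx E ((x, A) # G) \<longleftrightarrow> A \<in> Obj E \<and> wf_ctx E G"
  by (auto simp: wf_ctx_def)

lemma ctx_obj_Obj [simp]: "wf_ctx E G \<Longrightarrow> ctx_obj E G \<in> Obj E"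
  by (induction G) auto

lemma var_arr_hom: "wf_ctx E G \<Longrightarrow> map_of G x = Some A \<Longrightarrow> var_arr E G x \<in> hom E (ctx_obj E G) A"
  by (induction G) (auto simp: hom_iff split: if_splits)

lemma sem_hom: "has_type E G t A \<Longrightarrow> wf_ctx E G \<Longrightarrow> sem E G t \<in> hom E (ctx_obj E G) A"
proof (induction rule: has_type.induct)
  case (1 G x A)
  then show ?case by (simp add: var_arr_hom)
qed (auto simp: hom_iff)

text \<open>Agreement of the contexts is demanded only below \<open>N\<close>, a bound on all
  variables of \<open>t\<close>. A context may therefore receive a new variable \<open>N\<close>
  that shadows an older entry, as happens with the fresh variable of \<open>Exists\<close>.\<close>

lemma sem_substitution:
  assumes "has_type E G t A" "wf_ctx E G" "wf_ctx E H" "\<sigma> \<in> hom E (ctx_obj E H) (ctx_obj E G)"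
    and "\<And>y B. y < N \<Longrightarrow> map_of G y = Some B \<Longrightarrow>
      map_of H y = Some B \<and> var_arr E H y = var_arr E G y \<cdot> \<sigma>"
    and "fresh t \<le> N"
  shows "has_type E H t A \<and> sem E H t = sem E G t \<cdot> \<sigma>"
  using assms
proof (induction arbitrary: H \<sigma> rule: has_type.induct)
  case (1 G x A)
  then show ?case by (auto intro: has_type.intros)
next
  case (2 G)
  then show ?case by (auto intro: has_type.intros simp: hom_iff)
next
  case (3 f A B G t)
  have "has_type E H t A \<and> sem E H t = sem E G t \<cdot> \<sigma>" using 3 by simp
  then show ?case using 3(1,5,6) sem_hom[OF 3(2,4)] 3(4-6)
    by (auto intro: has_type.intros simp: hom_iff)
next
  case (4 G s A t B)
  have "has_type E H s A \<and> sem E H s = sem E G s \<cdot> \<sigma>"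
    "has_type E H t B \<and> sem E H t = sem E G t \<cdot> \<sigma>" using 4 by simp_all
  then show ?case using sem_hom[OF 4(1,5)] sem_hom[OF 4(2,5)] 4(6,7)
    by (auto intro: has_type.intros simp: hom_iff)
next
  case (5 A x G \<alpha>)
  \<comment> \<open>Under the binder the substitution keeps the bound component and acts by
    \<open>\<sigma>\<close> on the rest of the context.\<close>
  let ?s = "pairing E (Pr1 E A (ctx_obj E H)) (\<sigma> \<cdot> Pr2 E A (ctx_obj E H))"
  have f: "sem E ((x, A) # G) \<alpha> \<in> hom E (ProdObj E A (ctx_obj E G)) (Om E)"
    using sem_hom[OF 5(2)] 5(1,4) by simp
  have "has_type E ((x, A) # H) \<alpha> (Om E) \<and> sem E ((x, A) # H) \<alpha> = sem E ((x, A) # G) \<alpha> \<cdot> ?s"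
  proof (rule 5(3))
    show "?s \<in> hom E (ctx_obj E ((x, A) # H)) (ctx_obj E ((x, A) # G))"
      using 5(1,4,5,6) by (auto simp: hom_iff)
    fix y B assume y: "y < N" "map_of ((x, A) # G) y = Some B"
    show "map_of ((x, A) # H) y = Some B \<and> var_arr E ((x, A) # H) y = var_arr E ((x, A) # G) y \<cdot> ?s"
    proof (cases "y = x")
      case True
      then show ?thesis using y 5(1,4,5,6) by (auto simp: hom_iff)
    next
      case False
      then have "map_of G y = Some B" using y by simp
      from 5(7)[OF y(1) this] var_arr_hom[OF 5(4) this] show ?thesis
        using False 5(1,4,5,6) by (auto simp: hom_iff)
    qed
  qed (use 5 in auto)
  then show ?case using transpose_arr_comp[OF f 5(6,1)] 5(1) by (auto intro: has_type.intros)
next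
  case (6 G s A t)
  have "has_type E H s A \<and> sem E H s = sem E G s \<cdot> \<sigma>"
    "has_type E H t A \<and> sem E H t = sem E G t \<cdot> \<sigma>" using 6 by simp_all
  then show ?case using sem_hom[OF 6(1,5)] sem_hom[OF 6(2,5)] 6(6,7)
    by (auto intro: has_type.intros simp: hom_iff)
next
  case (7 G s A t)
  have "has_type E H s A \<and> sem E H s = sem E G s \<cdot> \<sigma>"
    "has_type E H t (PowObj E A) \<and> sem E H t = sem E G t \<cdot> \<sigma>" using 7 by simp_all
  then show ?case using sem_hom[OF 7(1,5)] sem_hom[OF 7(2,5)] 7(6,7)
    by (auto intro: has_type.intros simp: hom_iff)
qed

section \<open>Forcing and its clauses for the logical connectives\<close>

definition forces :: "'o ctx \<Rightarrow> 'a \<Rightarrow> ('o, 'a) tm \<Rightarrow> bool" where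
  "forces G t \<alpha> \<longleftrightarrow> sem E G \<alpha> \<cdot> t = true_on E (Dom E t)"

lemma forces_comp:
  assumes "forces G t \<alpha>" "has_type E G \<alpha> (Om E)" "wf_ctx E G" "t \<in> hom E T (ctx_obj E G)" "r \<in> hom E U T"
  shows "forces G (t \<cdot> r) \<alpha>"
proof -
  have s: "sem E G \<alpha> \<in> hom E (ctx_obj E G) (Om E)" by (rule sem_hom[OF assms(2,3)])
  have "(sem E G \<alpha> \<cdot> t) \<cdot> r = true_on E U"
    using assms(1,4,5) by (simp add: forces_def hom_iff)
  then show ?thesis using s assms(4,5) by (simp add: forces_def hom_iff)
qed

lemma forces_Var:
  assumes "wf_ctx E G" "A \<in> Obj E" "\<omega> \<in> hom E T A" "t \<in> hom E T (ctx_obj E G)"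
  shows "forces ((x, A) # G) (pairing E \<omega> t) (Var x) \<longleftrightarrow> \<omega> = true_on E T"
  using assms by (simp add: forces_def hom_iff)

lemma forces_Eq:
  assumes "has_type E G s A" "has_type E G u A" "wf_ctx E G" "t \<in> hom E T (ctx_obj E G)"
  shows "forces G t (Eq s u) \<longleftrightarrow> sem E G s \<cdot> t = sem E G u \<cdot> t"
proof -
  have h: "sem E G s \<in> hom E (ctx_obj E G) A" "sem E G u \<in> hom E (ctx_obj E G) A"
    using assms sem_hom by auto
  have "sem E G s \<cdot> t \<in> hom E T A" "sem E G u \<cdot> t \<in> hom E T A" using h assms(4) by (auto simp: hom_iff)
  from eq_arr_true[OF this] show ?thesis using h assms(4) by (simp add: forces_def hom_iff)
qed

lemma has_type_TT: "has_type E G TT (Om E)"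
  unfolding TT_def by (rule has_type.intros(6)[OF has_type.intros(2,2)])

lemma has_type_And: "has_type E G \<alpha> (Om E) \<Longrightarrow> has_type E G \<beta> (Om E) \<Longrightarrow> has_type E G (And \<alpha> \<beta>) (Om E)"
  unfolding And_def
  by (rule has_type.intros(6)[OF has_type.intros(4) has_type.intros(4)[OF has_type_TT has_type_TT]])

lemma has_type_Imp: "has_type E G \<alpha> (Om E) \<Longrightarrow> has_type E G \<beta> (Om E) \<Longrightarrow> has_type E G (Imp \<alpha> \<beta>) (Om E)"
  unfolding Imp_def by (rule has_type.intros(6)[OF has_type_And])

lemma has_type_Forall:
  "A \<in> Obj E \<Longrightarrow> has_type E ((x, A) # G) \<alpha> (Om E) \<Longrightarrow> has_type E G (Forall x A \<alpha>) (Om E)"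
  unfolding Forall_def by (rule has_type.intros(6)[OF has_type.intros(5) has_type.intros(5)[OF _ has_type_TT]])

lemma forces_TT:
  assumes "wf_ctx E G" "t \<in> hom E T (ctx_obj E G)"
  shows "forces G t TT"
  unfolding TT_def using assms by (subst forces_Eq) (auto intro: has_type.intros)

lemma forces_And:
  assumes "has_type E G \<alpha> (Om E)" "has_type E G \<beta> (Om E)" "wf_ctx E G" "t \<in> hom E T (ctx_obj E G)"
  shows "forces G t (And \<alpha> \<beta>) \<longleftrightarrow> forces G t \<alpha> \<and> forces G t \<beta>"
proof -
  note TT = has_type_TT
  have h: "sem E G \<alpha> \<in> hom E (ctx_obj E G) (Om E)" "sem E G \<beta> \<in> hom E (ctx_obj E G) (Om E)"
    "sem E G TT \<in> hom E (ctx_obj E G) (Om E)"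
    using assms TT sem_hom by auto
  have tt: "sem E G TT \<cdot> t = true_on E T"
    using forces_TT[OF assms(3,4)] assms(4) by (simp add: forces_def hom_iff)
  have l: "sem E G (PairT \<alpha> \<beta>) \<cdot> t = pairing E (sem E G \<alpha> \<cdot> t) (sem E G \<beta> \<cdot> t)"
    "sem E G (PairT TT TT) \<cdot> t = pairing E (true_on E T) (true_on E T)"
    using h assms(4) tt by (auto simp: hom_iff)
  have k: "sem E G \<alpha> \<cdot> t \<in> hom E T (Om E)" "sem E G \<beta> \<cdot> t \<in> hom E T (Om E)" "true_on E T \<in> hom E T (Om E)"
    using h assms(4) by (auto simp: hom_iff)
  have "forces G t (And \<alpha> \<beta>) \<longleftrightarrow> sem E G (PairT \<alpha> \<beta>) \<cdot> t = sem E G (PairT TT TT) \<cdot> t"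
    unfolding And_def 
    by (rule forces_Eq[OF has_type.intros(4)[OF assms(1,2)] has_type.intros(4)[OF TT TT] assms(3,4)])
  also have "\<dots> \<longleftrightarrow> forces G t \<alpha> \<and> forces G t \<beta>"
    unfolding l pairing_inject[OF k(1,2,3,3)] using assms(4) by (simp add: forces_def hom_iff)
  finally show ?thesis .
qed

text \<open>\<open>Imp\<close> equates the truth values of \<open>And \<alpha> \<beta>\<close> and
  \<open>\<alpha>\<close>, and by \<open>Om_ext\<close> this is a statement about all later stages;
  hence the change of stage \<open>r\<close>, absent from the clause for \<open>And\<close>.\<close>

lemma forces_Imp:
  assumes "has_type E G \<alpha> (Om E)" "has_type E G \<beta> (Om E)" "wf_ctx E G" "t \<in> hom E T (ctx_obj E G)"
  shows "forces G t (Imp \<alpha> \<beta>) \<longleftrightarrow>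
    (\<forall>U r. r \<in> hom E U T \<longrightarrow> forces G (t \<cdot> r) \<alpha> \<longrightarrow> forces G (t \<cdot> r) \<beta>)"
proof -
  note And = has_type_And[OF assms(1,2)]
  have h: "sem E G \<alpha> \<in> hom E (ctx_obj E G) (Om E)" "sem E G (And \<alpha> \<beta>) \<in> hom E (ctx_obj E G) (Om E)"
    using assms And sem_hom by auto
  have k: "sem E G \<alpha> \<cdot> t \<in> hom E T (Om E)" "sem E G (And \<alpha> \<beta>) \<cdot> t \<in> hom E T (Om E)"
    using h assms(4) by (auto simp: hom_iff)
  have tr: "t \<cdot> r \<in> hom E U (ctx_obj E G)" if "r \<in> hom E U T" for U r
    using that assms(4) by (simp add: hom_iff)
  have f: "(sem E G \<gamma> \<cdot> t) \<cdot> r = true_on E U \<longleftrightarrow> forces G (t \<cdot> r) \<gamma>"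
    if "r \<in> hom E U T" "sem E G \<gamma> \<in> hom E (ctx_obj E G) (Om E)" for U r \<gamma>
    using that assms(4) by (simp add: forces_def hom_iff)
  have "forces G t (Imp \<alpha> \<beta>) \<longleftrightarrow> sem E G (And \<alpha> \<beta>) \<cdot> t = sem E G \<alpha> \<cdot> t"
    unfolding Imp_def by (rule forces_Eq[OF And assms(1,3,4)])
  also have "\<dots> \<longleftrightarrow> (\<forall>U r. r \<in> hom E U T \<longrightarrow>
      (sem E G (And \<alpha> \<beta>) \<cdot> t) \<cdot> r = true_on E U \<longleftrightarrow> (sem E G \<alpha> \<cdot> t) \<cdot> r = true_on E U)"
    using Om_ext[OF k(2,1)] by metis
  also have "\<dots> \<longleftrightarrow> (\<forall>U r. r \<in> hom E U T \<longrightarrow> forces G (t \<cdot> r) \<alpha> \<longrightarrow> forces G (t \<cdot> r) \<beta>)"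
    using f h forces_And[OF assms(1,2,3) tr] by auto
  finally show ?thesis .
qed

text \<open>The encoding equates two comprehensions. Comparing their elements at all stages with
  those of \<open>TT\<close>, which is always forced, leaves the usual clause.\<close>

lemma forces_Forall:
  assumes "has_type E ((x, A) # G) \<alpha> (Om E)" "A \<in> Obj E" "wf_ctx E G" "t \<in> hom E T (ctx_obj E G)"
  shows "forces G t (Forall x A \<alpha>) \<longleftrightarrow>
    (\<forall>U r a. r \<in> hom E U T \<longrightarrow> a \<in> hom E U A \<longrightarrow> forces ((x, A) # G) (pairing E a (t \<cdot> r)) \<alpha>)"
proof -
  have wf: "wf_ctx E ((x, A) # G)" using assms by simp
  have h: "sem E ((x, A) # G) \<alpha> \<in> hom E (ProdObj E A (ctx_obj E G)) (Om E)"
    "sem E ((x, A) # G) TT \<in> hom E (ProdObj E A (ctx_obj E G)) (Om E)"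
    using sem_hom[OF assms(1) wf] sem_hom[OF has_type_TT wf] by auto
  have p: "pairing E a (t \<cdot> r) \<in> hom E U (ctx_obj E ((x, A) # G))"
    if "r \<in> hom E U T" "a \<in> hom E U A" for U r a
    using that assms(3,4) by (auto simp: hom_iff)
  have f: "sem E ((x, A) # G) \<gamma> \<cdot> pairing E a (t \<cdot> r) = true_on E U \<longleftrightarrow>
      forces ((x, A) # G) (pairing E a (t \<cdot> r)) \<gamma>"
    if "r \<in> hom E U T" "a \<in> hom E U A" for U r a \<gamma>
    using p[OF that] by (simp add: forces_def hom_iff)
  have "forces G t (Forall x A \<alpha>) \<longleftrightarrow> sem E G (SetOf x A \<alpha>) \<cdot> t = sem E G (SetOf x A TT) \<cdot> t"
    unfolding Forall_def
    by (rule forces_Eq[OF has_type.intros(5)[OF assms(2,1)] has_type.intros(5)[OF assms(2) has_type_TT]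
      assms(3,4)])
  also have "\<dots> \<longleftrightarrow> (\<forall>U r a. r \<in> hom E U T \<longrightarrow> a \<in> hom E U A \<longrightarrow>
      forces ((x, A) # G) (pairing E a (t \<cdot> r)) \<alpha>)"
    unfolding sem.simps transpose_eq_iff[OF h assms(4,4,2)] using f forces_TT[OF wf p] by auto
  finally show ?thesis .
qed

text \<open>The clauses for \<open>Forall\<close> and \<open>Imp\<close> together give two nested
  changes of stage. They collapse into one: the inner one may be the identity, and conversely it is
  absorbed into \<open>r\<close> and \<open>a\<close>. The encoding of \<open>Exists\<close>
  consists of two such combinations.\<close>

lemma forces_Forall_Imp:
  assumes "has_type E ((x, A) # G) \<alpha> (Om E)" "has_type E ((x, A) # G) \<beta> (Om E)" "A \<in> Obj E"
    "wf_ctx E G" "t \<in> hom E T (ctx_obj E G)"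
  shows "forces G t (Forall x A (Imp \<alpha> \<beta>)) \<longleftrightarrow>
    (\<forall>U r a. r \<in> hom E U T \<longrightarrow> a \<in> hom E U A \<longrightarrow>
       forces ((x, A) # G) (pairing E a (t \<cdot> r)) \<alpha> \<longrightarrow> forces ((x, A) # G) (pairing E a (t \<cdot> r)) \<beta>)"
    (is "_ \<longleftrightarrow> ?P")
proof -
  let ?G = "(x, A) # G"
  have wf: "wf_ctx E ?G" using assms by simp
  have p: "pairing E a (t \<cdot> r) \<in> hom E U (ctx_obj E ?G)" if "r \<in> hom E U T" "a \<in> hom E U A" for U r a
    using that assms(4,5) by (auto simp: hom_iff)
  have q: "pairing E a (t \<cdot> r) \<cdot> s = pairing E (a \<cdot> s) (t \<cdot> (r \<cdot> s))" "a \<cdot> s \<in> hom E V A" "r \<cdot> s \<in> hom E V T"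
    if "r \<in> hom E U T" "a \<in> hom E U A" "s \<in> hom E V U" for U V r a s
    using that assms(4,5) by (auto simp: hom_iff)
  have "forces G t (Forall x A (Imp \<alpha> \<beta>)) \<longleftrightarrow>
    (\<forall>U r a. r \<in> hom E U T \<longrightarrow> a \<in> hom E U A \<longrightarrow> (\<forall>V s. s \<in> hom E V U \<longrightarrow>
       forces ?G (pairing E a (t \<cdot> r) \<cdot> s) \<alpha> \<longrightarrow> forces ?G (pairing E a (t \<cdot> r) \<cdot> s) \<beta>))" (is "_ \<longleftrightarrow> ?Q")
    using forces_Forall[OF has_type_Imp[OF assms(1,2)] assms(3-5)] forces_Imp[OF assms(1,2) wf p]
    by simp
  also have "?Q \<longleftrightarrow> ?P"
  proof
    assume Q: ?Q
    show ?P
    proof (intro allI impI)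
      fix U r a assume ra: "r \<in> hom E U T" "a \<in> hom E U A"
        and f: "forces ?G (pairing E a (t \<cdot> r)) \<alpha>"
      have i: "Ide E U \<in> hom E U U" using ra by (simp add: hom_iff)
      have "pairing E a (t \<cdot> r) \<cdot> Ide E U = pairing E a (t \<cdot> r)" using p[OF ra] by (simp add: hom_iff)
      then show "forces ?G (pairing E a (t \<cdot> r)) \<beta>" using Q ra i f by metis
    qed
  next
    assume P: ?P
    show ?Q
    proof (intro allI impI)
      fix U r a V s assume ra: "r \<in> hom E U T" "a \<in> hom E U A" "s \<in> hom E V U"
        and "forces ?G (pairing E a (t \<cdot> r) \<cdot> s) \<alpha>"
      then show "forces ?G (pairing E a (t \<cdot> r) \<cdot> s) \<beta>"
        using P[rule_format, OF q(3,2)[OF ra]] unfolding q(1)[OF ra] by blast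
    qed
  qed
  finally show ?thesis .
qed

section \<open>The second-order existential quantifier\<close>

lemma has_type_rename:
  assumes "has_type E ((x, A) # G) \<alpha> (Om E)" "wf_ctx E G" "A \<in> Obj E" "B \<in> Obj E" "x < w" "fresh \<alpha> \<le> w"
  shows "has_type E ((x, A) # (w, B) # G) \<alpha> (Om E) \<and> sem E ((x, A) # (w, B) # G) \<alpha> =
    sem E ((x, A) # G) \<alpha> \<cdot> pairing E (Pr1 E A (ctx_obj E ((w, B) # G)))
      (Pr2 E B (ctx_obj E G) \<cdot> Pr2 E A (ctx_obj E ((w, B) # G)))"
proof (rule sem_substitution[where N = w])
  \<comment> \<open>Only variables below \<open>w\<close> matter for \<open>\<alpha>\<close>, so the
    inserted entry is skipped even if \<open>G\<close> already contains a variable with the number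
    \<open>w\<close>.\<close>
  fix y C assume y: "y < w" "map_of ((x, A) # G) y = Some C"
  then show "map_of ((x, A) # (w, B) # G) y = Some C \<and>
      var_arr E ((x, A) # (w, B) # G) y = var_arr E ((x, A) # G) y \<cdot>
        pairing E (Pr1 E A (ctx_obj E ((w, B) # G)))
          (Pr2 E B (ctx_obj E G) \<cdot> Pr2 E A (ctx_obj E ((w, B) # G)))"
    using assms(2-4) var_arr_hom[OF assms(2), of y C] by (auto simp: hom_iff split: if_splits)
qed (use assms in \<open>auto simp: hom_iff\<close>)

lemma has_type_Exists:
  assumes "has_type E ((x, A) # G) \<alpha> (Om E)" "wf_ctx E G" "A \<in> Obj E"
  shows "has_type E G (Exists E x A \<alpha>) (Om E)"
  unfolding Exists_def Let_def
  by (intro has_type_Forall has_type_Imp has_type.intros has_type_rename[THEN conjunct1] assms Om_Obj)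
    (auto simp: assms)

text \<open>The arrow \<open>\<omega>\<close> is the value of the fresh variable of the encoding.
  The outer quantifier introduces it at the stage \<open>r\<close>, and the inner one ranges over
  witnesses at the stages \<open>s\<close> beyond it.\<close>

lemma forces_Exists:
  assumes \<alpha>: "has_type E ((x, A) # G) \<alpha> (Om E)" and A: "A \<in> Obj E" and wf: "wf_ctx E G"
    and t: "t \<in> hom E T (ctx_obj E G)"
  shows "forces G t (Exists E x A \<alpha>) \<longleftrightarrow>
    (\<forall>U r \<omega>. r \<in> hom E U T \<longrightarrow> \<omega> \<in> hom E U (Om E) \<longrightarrow>
       (\<forall>V s a. s \<in> hom E V U \<longrightarrow> a \<in> hom E V A \<longrightarrow>
          forces ((x, A) # G) (pairing E a (t \<cdot> (r \<cdot> s))) \<alpha> \<longrightarrow> \<omega> \<cdot> s = true_on E V) \<longrightarrow>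
       \<omega> = true_on E U)"
proof -
  define w where "w = max (Suc x) (fresh \<alpha>)"
  let ?H = "(w, Om E) # G" and ?K = "(x, A) # (w, Om E) # G"
  have w: "x < w" "fresh \<alpha> \<le> w" by (auto simp: w_def)
  note ren = has_type_rename[OF \<alpha> wf A Om_Obj w]
  have wH: "wf_ctx E ?H" and wK: "wf_ctx E ?K" using A wf by auto
  have vw: "has_type E ?K (Var w) (Om E)" "has_type E ?H (Var w) (Om E)"
    using w by (auto intro!: has_type.intros)
  have imp: "has_type E ?H (Forall x A (Imp \<alpha> (Var w))) (Om E)"
    by (intro has_type_Forall has_type_Imp A vw ren[THEN conjunct1])
  have p: "pairing E \<omega> (t \<cdot> r) \<in> hom E U (ctx_obj E ?H)"
    if "r \<in> hom E U T" "\<omega> \<in> hom E U (Om E)" for U r \<omega>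
    using that t wf by (auto simp: hom_iff)
  have q: "forces ?K (pairing E a (pairing E \<omega> (t \<cdot> r) \<cdot> s)) \<alpha> \<longleftrightarrow>
      forces ((x, A) # G) (pairing E a (t \<cdot> (r \<cdot> s))) \<alpha>"
      "forces ?K (pairing E a (pairing E \<omega> (t \<cdot> r) \<cdot> s)) (Var w) \<longleftrightarrow> \<omega> \<cdot> s = true_on E V"
    if "r \<in> hom E U T" "\<omega> \<in> hom E U (Om E)" "s \<in> hom E V U" "a \<in> hom E V A" for U V r \<omega> s a
    using that t wf w sem_hom[OF \<alpha>] A by (auto simp: forces_def hom_iff ren[THEN conjunct2])
  have v: "forces ?H (pairing E \<omega> (t \<cdot> r)) (Var w) \<longleftrightarrow> \<omega> = true_on E U"
    if "r \<in> hom E U T" "\<omega> \<in> hom E U (Om E)" for U r \<omega>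
    by (rule forces_Var) (use that t wf in \<open>auto simp: hom_iff\<close>)
  show ?thesis
    unfolding Exists_def Let_def w_def[symmetric] forces_Forall_Imp[OF imp vw(2) Om_Obj wf t]
    using forces_Forall_Imp[OF ren[THEN conjunct1] vw(1) A wH p] q v by simp
qed

lemma forces_Mem_SetOf:
  assumes u: "has_type E G u A" and \<alpha>: "has_type E ((x, A) # G) \<alpha> (Om E)" and A: "A \<in> Obj E"
    and wf: "wf_ctx E G" and t: "t \<in> hom E T (ctx_obj E G)"
  shows "forces G t (Mem u (SetOf x A \<alpha>)) \<longleftrightarrow>
    forces ((x, A) # G) (pairing E (sem E G u \<cdot> t) t) \<alpha>"
proof -
  have s: "sem E ((x, A) # G) \<alpha> \<in> hom E (ProdObj E A (ctx_obj E G)) (Om E)"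
    using sem_hom[OF \<alpha>] A wf by simp
  have h: "sem E G u \<in> hom E (ctx_obj E G) A" by (rule sem_hom[OF u wf])
  then have ut: "sem E G u \<cdot> t \<in> hom E T A" using t by (simp add: hom_iff)
  show ?thesis
    using Elt_transpose[OF s ut t] s h t A wf by (simp add: forces_def hom_iff)
qed

lemma forces_ExistsI:
  assumes "has_type E ((x, A) # G) \<alpha> (Om E)" "wf_ctx E G" "t \<in> hom E T (ctx_obj E G)"
    and a: "a \<in> hom E T A" and f: "forces ((x, A) # G) (pairing E a t) \<alpha>"
  shows "forces G t (Exists E x A \<alpha>)"
proof -
  have A: "A \<in> Obj E" using a by (simp add: hom_iff)
  have wf: "wf_ctx E ((x, A) # G)" using A assms(2) by simp
  have p: "pairing E a t \<in> hom E T (ctx_obj E ((x, A) # G))"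
    using a assms(2,3) by (simp add: hom_iff)
  show ?thesis
    unfolding forces_Exists[OF assms(1) A assms(2,3)]
  proof (intro allI impI)
    fix U r \<omega> assume r: "r \<in> hom E U T"
      and h: "\<forall>V s b. s \<in> hom E V U \<longrightarrow> b \<in> hom E V A \<longrightarrow>
        forces ((x, A) # G) (pairing E b (t \<cdot> (r \<cdot> s))) \<alpha> \<longrightarrow> \<omega> \<cdot> s = true_on E V"
      and \<omega>: "\<omega> \<in> hom E U (Om E)"
    have "pairing E a t \<cdot> r = pairing E (a \<cdot> r) (t \<cdot> (r \<cdot> Ide E U))"
      using r a assms(2,3) by (simp add: hom_iff)
    then have "forces ((x, A) # G) (pairing E (a \<cdot> r) (t \<cdot> (r \<cdot> Ide E U))) \<alpha>"
      using forces_comp[OF f assms(1) wf p r] by simp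
    moreover have "Ide E U \<in> hom E U U" "a \<cdot> r \<in> hom E U A" using r a by (auto simp: hom_iff)
    ultimately have "\<omega> \<cdot> Ide E U = true_on E U" using h by blast
    then show "\<omega> = true_on E U" using \<omega> by (simp add: hom_iff)
  qed
qed

text \<open>Elimination at the current stage: the outer change of stage is the identity. The
  conclusion concerns a truth value, so every use has to encode its goal as one.\<close>

lemma forces_ExistsD:
  assumes "forces G t (Exists E x A \<alpha>)" "has_type E ((x, A) # G) \<alpha> (Om E)" "A \<in> Obj E" "wf_ctx E G"
    and t: "t \<in> hom E T (ctx_obj E G)" and \<omega>: "\<omega> \<in> hom E T (Om E)"
    and l: "\<And>U r a. r \<in> hom E U T \<Longrightarrow> a \<in> hom E U A \<Longrightarrow>
      forces ((x, A) # G) (pairing E a (t \<cdot> r)) \<alpha> \<Longrightarrow> \<omega> \<cdot> r = true_on E U"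
  shows "\<omega> = true_on E T"
proof -
  have i: "Ide E T \<in> hom E T T" using t by (simp add: hom_iff)
  have "Ide E T \<cdot> r = r" if "r \<in> hom E U T" for U r using that by (simp add: hom_iff)
  then show ?thesis
    using assms(1)[unfolded forces_Exists[OF assms(2-4) t], rule_format, OF i \<omega>] l by simp
qed

lemma holds_iff_forces:
  assumes "has_type E [] \<phi> (Om E)"
  shows "holds E \<phi> \<longleftrightarrow> forces [] (Ide E (One E)) \<phi>"
  using assms sem_hom[OF assms] by (simp add: holds_def forces_def hom_iff)

section \<open>Local surjectivity and images\<close>

text \<open>
  An arrow is a cover if truth values over its codomain can be checked after lifting generalized
  elements along it; this is how the second-order encoding of \<open>\<exists>\<close> expresses surjectivity, and
  it makes it unnecessary to know that epimorphisms are stable under pullback.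
\<close>

definition cover :: "'a \<Rightarrow> bool" where
  "cover f \<longleftrightarrow> (\<forall>T e \<omega>. e \<in> hom E T (Cod E f) \<longrightarrow> \<omega> \<in> hom E T (Om E) \<longrightarrow>
     (\<forall>U r x. r \<in> hom E U T \<longrightarrow> x \<in> hom E U (Dom E f) \<longrightarrow> f \<cdot> x = e \<cdot> r \<longrightarrow> \<omega> \<cdot> r = true_on E U) \<longrightarrow>
     \<omega> = true_on E T)"

lemma coverD:
  assumes "cover f" "f \<in> hom E X Y" "e \<in> hom E T Y" "\<omega> \<in> hom E T (Om E)"
    and "\<And>U r x. r \<in> hom E U T \<Longrightarrow> x \<in> hom E U X \<Longrightarrow> f \<cdot> x = e \<cdot> r \<Longrightarrow> \<omega> \<cdot> r = true_on E U"
  shows "\<omega> = true_on E T"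
proof -
  have "Dom E f = X" "Cod E f = Y" using assms by (auto simp: hom_iff)
  then show ?thesis using assms unfolding cover_def by blast
qed

lemma coverI:
  assumes "f \<in> hom E X Y"
    and "\<And>T e \<omega>. e \<in> hom E T Y \<Longrightarrow> \<omega> \<in> hom E T (Om E) \<Longrightarrow>
      (\<And>U r x. r \<in> hom E U T \<Longrightarrow> x \<in> hom E U X \<Longrightarrow> f \<cdot> x = e \<cdot> r \<Longrightarrow> \<omega> \<cdot> r = true_on E U) \<Longrightarrow>
      \<omega> = true_on E T"
  shows "cover f"
proof -
  have "Dom E f = X" "Cod E f = Y" using assms by (auto simp: hom_iff)
  then show ?thesis using assms(2) unfolding cover_def by blast
qed

text \<open>Elimination into truth values becomes elimination into equations by taking
  \<open>\<omega>\<close> to be the truth value of \<open>g = h\<close>.\<close>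

lemma cover_eqI:
  assumes "cover f" "f \<in> hom E X Y" "e \<in> hom E T Y" and g: "g \<in> hom E T Z" and h: "h \<in> hom E T Z"
    and l: "\<And>U r x. r \<in> hom E U T \<Longrightarrow> x \<in> hom E U X \<Longrightarrow> f \<cdot> x = e \<cdot> r \<Longrightarrow> g \<cdot> r = h \<cdot> r"
  shows "g = h"
proof -
  have \<omega>: "eq_arr E Z \<cdot> pairing E g h \<in> hom E T (Om E)" using g h by (auto simp: hom_iff)
  have "eq_arr E Z \<cdot> pairing E g h = true_on E T"
  proof (rule coverD[OF assms(1-3) \<omega>])
    fix U r x assume r: "r \<in> hom E U T" and x: "x \<in> hom E U X" and fx: "f \<cdot> x = e \<cdot> r"
    have "g \<cdot> r \<in> hom E U Z" using r g by (simp add: hom_iff)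
    then have "eq_arr E Z \<cdot> pairing E (g \<cdot> r) (h \<cdot> r) = true_on E U"
      using l[OF r x fx] eq_arr_true by simp
    then show "(eq_arr E Z \<cdot> pairing E g h) \<cdot> r = true_on E U" using g h r by (simp add: hom_iff)
  qed
  then show ?thesis using eq_arr_true[OF g h] by simp
qed

lemma cover_epi:
  assumes "cover f" "f \<in> hom E X Y" "g \<in> hom E Y Z" "h \<in> hom E Y Z" "g \<cdot> f = h \<cdot> f"
  shows "g = h"
proof (rule cover_eqI[OF assms(1,2) _ assms(3,4)])
  show "Ide E Y \<in> hom E Y Y" using assms by (simp add: hom_iff)
  fix U r x assume h: "r \<in> hom E U Y" "x \<in> hom E U X" "f \<cdot> x = Ide E Y \<cdot> r"
  have "g \<cdot> (f \<cdot> x) = (g \<cdot> f) \<cdot> x" "h \<cdot> (f \<cdot> x) = (h \<cdot> f) \<cdot> x"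
    using h(1,2) assms(2-4) by (auto simp: hom_iff)
  then have "g \<cdot> (f \<cdot> x) = h \<cdot> (f \<cdot> x)" using assms(5) by simp
  then show "g \<cdot> r = h \<cdot> r" using h assms by (simp add: hom_iff)
qed

lemma cover_compD:
  assumes c: "cover (g \<cdot> f)" and f: "f \<in> hom E X Y" and g: "g \<in> hom E Y Z"
  shows "cover g"
proof (rule coverI[OF g])
  fix T e \<omega> assume e: "e \<in> hom E T Z" and \<omega>: "\<omega> \<in> hom E T (Om E)"
    and l: "\<And>U r x. r \<in> hom E U T \<Longrightarrow> x \<in> hom E U Y \<Longrightarrow> g \<cdot> x = e \<cdot> r \<Longrightarrow> \<omega> \<cdot> r = true_on E U"
  have gf: "g \<cdot> f \<in> hom E X Z" using f g by (simp add: hom_iff)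
  show "\<omega> = true_on E T"
  proof (rule coverD[OF c gf e \<omega>])
    fix U r x assume r: "r \<in> hom E U T" and x: "x \<in> hom E U X" and eq: "(g \<cdot> f) \<cdot> x = e \<cdot> r"
    show "\<omega> \<cdot> r = true_on E U"
      by (rule l[OF r, of "f \<cdot> x"]) (use f g x eq in \<open>auto simp: hom_iff\<close>)
  qed
qed

text \<open>The classifying arrow of \<open>m\<close> is true after lifting along \<open>m\<close>,
  hence true outright because \<open>m\<close> is a cover; so the identity of \<open>Z\<close>
  factors through \<open>m\<close>. As \<open>m\<close> is monic, this section is a two-sided
  inverse.\<close>

lemma monic_cover_section:
  assumes m: "m \<in> hom E M Z" "is_monic E m" and c: "cover m"
  shows "\<exists>n. n \<in> hom E Z M \<and> m \<cdot> n = Ide E Z"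
proof -
  have "Cod E m = Z" "Dom E m = M" using m by (auto simp: hom_iff)
  then obtain \<chi> where \<chi>: "\<chi> \<in> hom E Z (Om E)" and pb: "is_pullback E \<chi> (Tru E) m (bang E M)"
    using classifier[OF m(2)] by auto
  from pb[unfolded is_pullback_Tru_iff[OF \<chi> m(1)]]
  have t: "\<chi> \<cdot> m = true_on E M" and
    ex: "\<And>T u. u \<in> hom E T Z \<Longrightarrow> \<chi> \<cdot> u = true_on E T \<Longrightarrow> \<exists>h. h \<in> hom E T M \<and> m \<cdot> h = u"
    by blast+
  have i: "Ide E Z \<in> hom E Z Z" using m(1) by (simp add: hom_iff)
  have "\<chi> = true_on E Z"
  proof (rule coverD[OF c m(1) i \<chi>])
    fix U r x assume h: "r \<in> hom E U Z" "x \<in> hom E U M" "m \<cdot> x = Ide E Z \<cdot> r"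
    have "(\<chi> \<cdot> m) \<cdot> x = true_on E U" unfolding t using h(2) by (simp add: hom_iff)
    then show "\<chi> \<cdot> r = true_on E U" using h \<chi> m(1) by (simp add: hom_iff)
  qed
  then have "\<chi> \<cdot> Ide E Z = true_on E Z" using \<chi> by (simp add: hom_iff)
  from ex[OF i this] show ?thesis .
qed

text \<open>Here \<open>\<chi>\<close> is the truth value of membership in the image:
  \<open>\<chi>f\<close> acts as introduction and \<open>elim\<close> as elimination rule of an
  existential quantifier. The abstract form serves both general images and the quotient set, whose
  formulas differ.\<close>

lemma image_cover:
  assumes f: "f \<in> hom E X Y" and \<chi>: "\<chi> \<in> hom E Y (Om E)" and \<chi>f: "\<chi> \<cdot> f = true_on E X"
    and elim: "\<And>T y \<omega>. y \<in> hom E T Y \<Longrightarrow> \<chi> \<cdot> y = true_on E T \<Longrightarrow> \<omega> \<in> hom E T (Om E) \<Longrightarrow>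
      (\<And>U r x. r \<in> hom E U T \<Longrightarrow> x \<in> hom E U X \<Longrightarrow> f \<cdot> x = y \<cdot> r \<Longrightarrow> \<omega> \<cdot> r = true_on E U) \<Longrightarrow>
      \<omega> = true_on E T"
  defines "m \<equiv> Pb1 E \<chi> (Tru E)"
  shows "\<exists>p. p \<in> hom E X (Dom E m) \<and> m \<cdot> p = f \<and> cover p"
proof -
  note m = classified_subobject[OF \<chi>, folded m_def]
  from m(3)[unfolded is_pullback_Tru_iff[OF \<chi> m(1)]]
  have t: "\<chi> \<cdot> m = true_on E (Dom E m)" and
    ex: "\<And>T u. u \<in> hom E T Y \<Longrightarrow> \<chi> \<cdot> u = true_on E T \<Longrightarrow> \<exists>h. h \<in> hom E T (Dom E m) \<and> m \<cdot> h = u"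
    by blast+
  from ex[OF f \<chi>f] obtain p where p: "p \<in> hom E X (Dom E m)" "m \<cdot> p = f" by blast
  have "cover p"
  proof (rule coverI[OF p(1)])
    fix T e \<omega> assume e: "e \<in> hom E T (Dom E m)" and \<omega>: "\<omega> \<in> hom E T (Om E)"
      and l: "\<And>U r x. r \<in> hom E U T \<Longrightarrow> x \<in> hom E U X \<Longrightarrow> p \<cdot> x = e \<cdot> r \<Longrightarrow> \<omega> \<cdot> r = true_on E U"
    have y: "m \<cdot> e \<in> hom E T Y" using m(1) e by (auto simp: hom_iff)
    have "(\<chi> \<cdot> m) \<cdot> e = true_on E T" unfolding t using e by (simp add: hom_iff)
    then have "\<chi> \<cdot> (m \<cdot> e) = true_on E T" using m(1) e \<chi> by (simp add: hom_iff)
    then show "\<omega> = true_on E T"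
    \<comment> \<open>Lifts of \<open>m \<cdot> e\<close> along \<open>f\<close> are lifts of
      \<open>e\<close> along \<open>p\<close>, because \<open>m\<close> is monic.\<close>
    proof (rule elim[OF y _ \<omega>])
      fix U r x assume r: "r \<in> hom E U T" and x: "x \<in> hom E U X" and fx: "f \<cdot> x = (m \<cdot> e) \<cdot> r"
      have px: "p \<cdot> x \<in> hom E U (Dom E m)" "e \<cdot> r \<in> hom E U (Dom E m)"
        using p(1) e r x by (auto simp: hom_iff)
      have "m \<cdot> (p \<cdot> x) = (m \<cdot> p) \<cdot> x" using m(1) p(1) x by (simp add: hom_iff)
      also have "\<dots> = m \<cdot> (e \<cdot> r)" unfolding p(2) fx using m(1) e r by (simp add: hom_iff)
      finally have "p \<cdot> x = e \<cdot> r" by (rule is_monicD[OF m(2) _ m(1) px])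
      then show "\<omega> \<cdot> r = true_on E U" by (rule l[OF r x])
    qed
  qed
  with p show ?thesis by blast
qed

text \<open>The image is the subobject classified by the formula
  \<open>\<exists>x. f(x) = y\<close>, with variable 1 for \<open>x\<close> and variable 0 for
  \<open>y\<close>.\<close>

lemma image_factorization:
  assumes f: "f \<in> hom E X Y"
  shows "\<exists>I m p. m \<in> hom E I Y \<and> is_monic E m \<and> p \<in> hom E X I \<and> m \<cdot> p = f \<and> cover p"
proof -
  have o: "X \<in> Obj E" "Y \<in> Obj E" using f by (auto simp: hom_iff)
  let ?G = "[(0::nat, Y)]" and ?H = "[(1::nat, X), (0::nat, Y)]"
  let ?\<beta> = "Eq (App f (Var 1)) (Var 0) :: ('o, 'a) tm"
  have wf: "wf_ctx E ?G" "wf_ctx E ?H" using o by auto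
  have v: "has_type E ?H (App f (Var 1)) Y" "has_type E ?H (Var 0) Y"
    by (rule has_type.intros(3)[OF f] has_type.intros(1); simp)+
  have \<beta>: "has_type E ?H ?\<beta> (Om E)" by (rule has_type.intros(6)[OF v])
  have ex: "has_type E ?G (Exists E 1 X ?\<beta>) (Om E)" by (rule has_type_Exists[OF \<beta> wf(1) o(1)])
  let ?\<chi> = "arrow_of E 0 Y (Exists E 1 X ?\<beta>)"
  have s: "sem E ?G (Exists E 1 X ?\<beta>) \<in> hom E (ProdObj E Y (One E)) (Om E)"
    using sem_hom[OF ex wf(1)] by simp
  then have \<chi>: "?\<chi> \<in> hom E Y (Om E)" using o by (simp add: arrow_of_def hom_iff)
  have c: "pairing E y (bang E T) \<in> hom E T (ctx_obj E ?G)" if "y \<in> hom E T Y" for T y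
    using that by (auto simp: hom_iff)
  have \<chi>y: "?\<chi> \<cdot> y = true_on E T \<longleftrightarrow> forces ?G (pairing E y (bang E T)) (Exists E 1 X ?\<beta>)"
    if "y \<in> hom E T Y" for T y
    using that s o by (simp add: arrow_of_def forces_def hom_iff)
  have body: "forces ?H (pairing E x (pairing E y (bang E T))) ?\<beta> \<longleftrightarrow> f \<cdot> x = y"
    if "x \<in> hom E T X" "y \<in> hom E T Y" for T x y
    by (subst forces_Eq[OF v wf(2), of _ T]) (use that f o in \<open>auto simp: hom_iff\<close>)
  have i: "Ide E X \<in> hom E X X" using o by (simp add: hom_iff)
  have "f \<cdot> Ide E X = f" using f by (simp add: hom_iff)
  then have "?\<chi> \<cdot> f = true_on E X"
    unfolding \<chi>y[OF f] by (intro forces_ExistsI[OF \<beta> wf(1) c[OF f] i] body[OF i f, THEN iffD2])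
  then have "\<exists>p. p \<in> hom E X (Dom E (Pb1 E ?\<chi> (Tru E))) \<and> Pb1 E ?\<chi> (Tru E) \<cdot> p = f \<and> cover p"
  proof (rule image_cover[OF f \<chi>])
    fix T y \<omega> assume y: "y \<in> hom E T Y" and t: "?\<chi> \<cdot> y = true_on E T" and \<omega>: "\<omega> \<in> hom E T (Om E)"
      and l: "\<And>U r x. r \<in> hom E U T \<Longrightarrow> x \<in> hom E U X \<Longrightarrow> f \<cdot> x = y \<cdot> r \<Longrightarrow> \<omega> \<cdot> r = true_on E U"
    show "\<omega> = true_on E T"
    proof (rule forces_ExistsD[OF _ \<beta> o(1) wf(1) c[OF y] \<omega>])
      show "forces ?G (pairing E y (bang E T)) (Exists E 1 X ?\<beta>)" using t \<chi>y[OF y] by simp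
      fix U r a assume r: "r \<in> hom E U T" and a: "a \<in> hom E U X"
        and fo: "forces ?H (pairing E a (pairing E y (bang E T) \<cdot> r)) ?\<beta>"
      have yr: "y \<cdot> r \<in> hom E U Y" "pairing E y (bang E T) \<cdot> r = pairing E (y \<cdot> r) (bang E U)"
        using y r by (auto simp: hom_iff)
      show "\<omega> \<cdot> r = true_on E U" using l[OF r a] fo body[OF a yr(1)] unfolding yr(2) by simp
    qed
  qed
  then show ?thesis using classified_subobject[OF \<chi>] by blast
qed

text \<open>The descended arrow is read off from the image of \<open>\<langle>q, f\<rangle>\<close>, its graph.\<close>

lemma cover_descent:
  assumes c: "cover q" and q: "q \<in> hom E X Q" and f: "f \<in> hom E X Z"
    and resp: "\<And>T x y. x \<in> hom E T X \<Longrightarrow> y \<in> hom E T X \<Longrightarrow> q \<cdot> x = q \<cdot> y \<Longrightarrow> f \<cdot> x = f \<cdot> y"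
  shows "\<exists>g. g \<in> hom E Q Z \<and> g \<cdot> q = f"
proof -
  have o: "Q \<in> Obj E" "Z \<in> Obj E" using q f by (auto simp: hom_iff)
  have "pairing E q f \<in> hom E X (ProdObj E Q Z)" using q f by (auto simp: hom_iff)
  from image_factorization[OF this] obtain I m p where m: "m \<in> hom E I (ProdObj E Q Z)" "is_monic E m"
    and p: "p \<in> hom E X I" "m \<cdot> p = pairing E q f" "cover p" by blast
  \<comment> \<open>Projection of the graph to its source: the graph is functional when
    \<open>k\<close> is monic and total when \<open>k\<close> is a cover.\<close>
  define k where "k = Pr1 E Q Z \<cdot> m"
  have k: "k \<in> hom E I Q" unfolding k_def using m(1) o by (simp add: hom_iff)
  have "k \<cdot> p = Pr1 E Q Z \<cdot> (m \<cdot> p)" unfolding k_def using m(1) p(1) o by (simp add: hom_iff)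
  also have "\<dots> = q" unfolding p(2) using q f by (simp add: hom_iff)
  finally have kp: "k \<cdot> p = q" .
  have kpx: "k \<cdot> (p \<cdot> x) = q \<cdot> x" if "x \<in> hom E T X" for x T
    using k p(1) that by (simp add: kp[symmetric] hom_iff)
  have mpx: "m \<cdot> (p \<cdot> x) = pairing E (q \<cdot> x) (f \<cdot> x)" if x: "x \<in> hom E T X" for x T
  proof -
    have "m \<cdot> (p \<cdot> x) = (m \<cdot> p) \<cdot> x" using m(1) p(1) x by (simp add: hom_iff)
    then show ?thesis unfolding p(2) using x q f by (simp add: hom_iff)
  qed
  \<comment> \<open>Two points of the graph over the same point of \<open>Q\<close> are lifted to
    \<open>X\<close>, by one cover elimination for each. The lifts have the same image under
    \<open>q\<close>, so \<open>resp\<close> gives them the same image under \<open>f\<close>, and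
    the graph points coincide.\<close>
  have mk: "is_monic E k"
  proof (rule is_monicI[OF k])
    fix T u v assume u: "u \<in> hom E T I" and v: "v \<in> hom E T I" and kuv: "k \<cdot> u = k \<cdot> v"
    show "u = v"
    proof (rule cover_eqI[OF p(3,1) u u v])
      fix U r x assume r: "r \<in> hom E U T" and x: "x \<in> hom E U X" and px: "p \<cdot> x = u \<cdot> r"
      have ur: "u \<cdot> r \<in> hom E U I" and vr: "v \<cdot> r \<in> hom E U I" using u v r by (auto simp: hom_iff)
      show "u \<cdot> r = v \<cdot> r"
      proof (rule cover_eqI[OF p(3,1) vr ur vr])
        fix V s y assume s: "s \<in> hom E V U" and y: "y \<in> hom E V X" and py: "p \<cdot> y = (v \<cdot> r) \<cdot> s"
        have xs: "x \<cdot> s \<in> hom E V X" using x s by (simp add: hom_iff)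
        have "p \<cdot> (x \<cdot> s) = (p \<cdot> x) \<cdot> s" using p(1) x s by (simp add: hom_iff)
        then have pxs: "p \<cdot> (x \<cdot> s) = (u \<cdot> r) \<cdot> s" unfolding px .
        have "k \<cdot> ((u \<cdot> r) \<cdot> s) = (k \<cdot> u) \<cdot> (r \<cdot> s)" "k \<cdot> ((v \<cdot> r) \<cdot> s) = (k \<cdot> v) \<cdot> (r \<cdot> s)"
          using k u v r s by (auto simp: hom_iff)
        then have e: "q \<cdot> (x \<cdot> s) = q \<cdot> y"
          using kpx[OF xs] kpx[OF y] kuv unfolding pxs py by simp
        have "m \<cdot> (p \<cdot> (x \<cdot> s)) = m \<cdot> (p \<cdot> y)"
          unfolding mpx[OF xs] mpx[OF y] e resp[OF xs y e] ..
        then have "p \<cdot> (x \<cdot> s) = p \<cdot> y"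
          by (rule is_monicD[OF m(2) _ m(1)]) (use p(1) xs y in \<open>auto simp: hom_iff\<close>)
        then show "(u \<cdot> r) \<cdot> s = (v \<cdot> r) \<cdot> s" unfolding pxs py .
      qed
    qed
  qed
  have "cover k" by (rule cover_compD[OF _ p(1) k]) (simp add: kp c)
  from monic_cover_section[OF k mk this] obtain n where n: "n \<in> hom E Q I" "k \<cdot> n = Ide E Q" by blast
  have "k \<cdot> (n \<cdot> q) = (k \<cdot> n) \<cdot> q" using k n(1) q by (simp add: hom_iff)
  then have "k \<cdot> (n \<cdot> q) = k \<cdot> p" unfolding n(2) kp using q by (simp add: hom_iff)
  \<comment> \<open>Since \<open>k\<close> is monic, the section \<open>n\<close> agrees along
    \<open>q\<close> with \<open>p\<close>, whose second component is \<open>f\<close>.\<close>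
  then have nq: "n \<cdot> q = p"
    by (rule is_monicD[OF mk _ k]) (use n(1) q p(1) in \<open>auto simp: hom_iff\<close>)
  have "(Pr2 E Q Z \<cdot> (m \<cdot> n)) \<cdot> q = Pr2 E Q Z \<cdot> (m \<cdot> (n \<cdot> q))"
    using m(1) n(1) q o by (simp add: hom_iff)
  also have "\<dots> = f" unfolding nq p(2) using q f by (simp add: hom_iff)
  finally have "(Pr2 E Q Z \<cdot> (m \<cdot> n)) \<cdot> q = f" .
  moreover have "Pr2 E Q Z \<cdot> (m \<cdot> n) \<in> hom E Q Z" using m(1) n(1) o by (simp add: hom_iff)
  ultimately show ?thesis by blast
qed

end


section \<open>The equivalence relation of a modality\<close>

locale modal_topos = topos E for E :: "('o, 'a) topos_data" (structure) +
  fixes \<mu> :: 'a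
  assumes modality: "modality E \<mu>"
begin

section \<open>The modality as an operation on truth values\<close>

lemma \<mu>_simps [simp]: "\<mu> \<in> Arr E" "Dom E \<mu> = Om E" "Cod E \<mu> = Om E"
  using modality by (auto simp: modality_def hom_def)

text \<open>The axioms of a modality speak of formulas in context, the proof of arrows into
  \<open>Om E\<close>. An arrow \<open>a\<close> becomes the formula \<open>App a (Var 0)\<close> in
  a one-variable context, whose object is \<open>ProdObj E Z (One E)\<close> rather than
  \<open>Z\<close>; a projection here, and \<open>?t\<close> in the converse lemma, account for the
  extra factor.\<close>

lemma entails_AppI:
  assumes a: "a \<in> hom E Z (Om E)" and b: "b \<in> hom E Z (Om E)"
    and ab: "\<And>T t. t \<in> hom E T Z \<Longrightarrow> a \<cdot> t = true_on E T \<Longrightarrow> b \<cdot> t = true_on E T"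
  shows "entails E [(0, Z)] (App a (Var 0)) (App b (Var 0))"
  unfolding entails_def
proof (intro allI impI)
  fix T t assume t: "t \<in> hom E T (ctx_obj E [(0, Z)])"
    and at: "sem E [(0, Z)] (App a (Var 0)) \<cdot> t = true_on E T"
  have "Pr1 E Z (One E) \<cdot> t \<in> hom E T Z" using a t by (simp add: hom_iff)
  from ab[OF this] show "sem E [(0, Z)] (App b (Var 0)) \<cdot> t = true_on E T"
    using a b t at by (simp add: hom_iff)
qed

lemma entails_AppD:
  assumes "entails E [(0, Z)] (App a (Var 0)) (App b (Var 0))"
    and a: "a \<in> hom E Z (Om E)" and b: "b \<in> hom E Z (Om E)" and "a = true_on E Z"
  shows "b = true_on E Z"
proof -
  let ?t = "pairing E (Ide E Z) (bang E Z)"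
  have "?t \<in> hom E Z (ctx_obj E [(0, Z)])" using a by (simp add: hom_iff)
  then have "sem E [(0, Z)] (App a (Var 0)) \<cdot> ?t = true_on E Z \<longrightarrow>
      sem E [(0, Z)] (App b (Var 0)) \<cdot> ?t = true_on E Z"
    using assms(1) unfolding entails_def by blast
  then show ?thesis using assms(4) a b by (auto simp: hom_iff)
qed

lemma has_type_App_Var: "a \<in> hom E Z (Om E) \<Longrightarrow> has_type E [(0, Z)] (App a (Var 0)) (Om E)"
  by (rule has_type.intros(3)[OF _ has_type.intros(1)]) auto

text \<open>\<open>entails\<close> depends only on interpretations, so nested applications in the
  axioms can be traded for one application of a composite arrow.\<close>

lemma sem_App_App:
  assumes "a \<in> hom E Z (Om E)" "f \<in> hom E (Om E) (Om E)"
  shows "sem E [(0, Z)] (App f (App a (Var 0))) = sem E [(0, Z)] (App (f \<cdot> a) (Var 0))"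
  using assms by (simp add: hom_iff)

lemma modal_mono:
  assumes a: "a \<in> hom E Z (Om E)" and b: "b \<in> hom E Z (Om E)"
    and ab: "\<And>T t. t \<in> hom E T Z \<Longrightarrow> a \<cdot> t = true_on E T \<Longrightarrow> b \<cdot> t = true_on E T"
    and t: "\<mu> \<cdot> a = true_on E Z"
  shows "\<mu> \<cdot> b = true_on E Z"
proof -
  have wf: "wf_ctx E [(0, Z)]" using a by (simp add: hom_iff)
  have \<mu>: "\<mu> \<in> hom E (Om E) (Om E)" by (simp add: hom_iff)
  have "entails E [(0, Z)] (App \<mu> (App a (Var 0))) (App \<mu> (App b (Var 0)))"
    using modality entails_AppI[OF a b ab] wf has_type_App_Var[OF a] has_type_App_Var[OF b]
    unfolding modality_def by blast
  then have "entails E [(0, Z)] (App (\<mu> \<cdot> a) (Var 0)) (App (\<mu> \<cdot> b) (Var 0))"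
    unfolding entails_def sem_App_App[OF a \<mu>] sem_App_App[OF b \<mu>] .
  then show ?thesis by (rule entails_AppD) (use a b t in \<open>auto simp: hom_iff\<close>)
qed

lemma modal_unit:
  assumes Z: "Z \<in> Obj E"
  shows "\<mu> \<cdot> true_on E Z = true_on E Z"
proof -
  have \<mu>: "\<mu> \<in> hom E (Om E) (Om E)" by (simp add: hom_iff)
  have a: "true_on E Z \<in> hom E Z (Om E)" using Z by (simp add: hom_iff)
  have wf: "wf_ctx E [(0, Z)]" using Z by simp
  have "entails E [(0, Z)] (App (true_on E Z) (Var 0)) (App \<mu> (App (true_on E Z) (Var 0)))"
    using modality wf has_type_App_Var[OF a] unfolding modality_def by blast
  then have "entails E [(0, Z)] (App (true_on E Z) (Var 0)) (App (\<mu> \<cdot> true_on E Z) (Var 0))"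
    unfolding entails_def sem_App_App[OF a \<mu>] .
  then show ?thesis by (rule entails_AppD) (use a in \<open>auto simp: hom_iff\<close>)
qed

lemma modal_idem:
  assumes a: "a \<in> hom E Z (Om E)" and t: "\<mu> \<cdot> (\<mu> \<cdot> a) = true_on E Z"
  shows "\<mu> \<cdot> a = true_on E Z"
proof -
  have \<mu>: "\<mu> \<in> hom E (Om E) (Om E)" by (simp add: hom_iff)
  have wf: "wf_ctx E [(0, Z)]" using a by (simp add: hom_iff)
  have "entails E [(0, Z)] (App \<mu> (App \<mu> (App a (Var 0)))) (App \<mu> (App a (Var 0)))"
    using modality wf has_type_App_Var[OF a] unfolding modality_def by blast
  moreover have "sem E [(0, Z)] (App \<mu> (App \<mu> (App a (Var 0)))) = sem E [(0, Z)] (App (\<mu> \<cdot> (\<mu> \<cdot> a)) (Var 0))"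
    using a by (simp add: hom_iff)
  ultimately have "entails E [(0, Z)] (App (\<mu> \<cdot> (\<mu> \<cdot> a)) (Var 0)) (App (\<mu> \<cdot> a) (Var 0))"
    unfolding entails_def sem_App_App[OF a \<mu>] by simp
  then show ?thesis by (rule entails_AppD) (use a t in \<open>auto simp: hom_iff\<close>)
qed

section \<open>Nearness of generalized elements\<close>

definition near :: "'a \<Rightarrow> 'a \<Rightarrow> bool" where
  "near x y \<longleftrightarrow> \<mu> \<cdot> (eq_arr E (Cod E x) \<cdot> pairing E x y) = true_on E (Dom E x)"

lemma near_iff: "x \<in> hom E T A \<Longrightarrow> near x y \<longleftrightarrow> \<mu> \<cdot> (eq_arr E A \<cdot> pairing E x y) = true_on E T"
  by (simp add: near_def hom_iff)

text \<open>Monotonicity of \<open>\<mu>\<close> with the equality of \<open>x\<close> and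
  \<open>y\<close> as premise: the hypothesis \<open>xy\<close>, tested at all stages, says that
  this equality entails \<open>b\<close>.\<close>

lemma near_modal:
  assumes n: "near x y" and x: "x \<in> hom E T A" and y: "y \<in> hom E T A" and b: "b \<in> hom E T (Om E)"
    and xy: "\<And>U t. t \<in> hom E U T \<Longrightarrow> x \<cdot> t = y \<cdot> t \<Longrightarrow> b \<cdot> t = true_on E U"
  shows "\<mu> \<cdot> b = true_on E T"
proof (rule modal_mono[OF _ b])
  show "eq_arr E A \<cdot> pairing E x y \<in> hom E T (Om E)" using x y by (simp add: hom_iff)
  show "\<mu> \<cdot> (eq_arr E A \<cdot> pairing E x y) = true_on E T" using n near_iff[OF x] by simp
  fix U t assume t: "t \<in> hom E U T" and e: "(eq_arr E A \<cdot> pairing E x y) \<cdot> t = true_on E U"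
  have h: "x \<cdot> t \<in> hom E U A" "y \<cdot> t \<in> hom E U A" using x y t by (auto simp: hom_iff)
  have "x \<cdot> t = y \<cdot> t" unfolding eq_arr_true[OF h, symmetric] using e x y t by (simp add: hom_iff)
  then show "b \<cdot> t = true_on E U" by (rule xy[OF t])
qed

lemma near_comp:
  assumes n: "near x y" and x: "x \<in> hom E T A" and y: "y \<in> hom E T A" and t: "t \<in> hom E U T"
  shows "near (x \<cdot> t) (y \<cdot> t)"
proof -
  have "(\<mu> \<cdot> (eq_arr E A \<cdot> pairing E x y)) \<cdot> t = true_on E U"
    using n t unfolding near_iff[OF x] by (simp add: hom_iff)
  then show ?thesis using x y t by (simp add: near_def hom_iff)
qed

lemma near_refl: "x \<in> hom E T A \<Longrightarrow> near x x"
  using eq_arr_true[of x T A x] modal_unit by (simp add: near_def hom_iff)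

text \<open>The instance of \<open>near_modal\<close> where \<open>b\<close> is itself an equation.
  Symmetry, invariance under arrows and the two moves in a product are all of this kind.\<close>

lemma near_map:
  assumes n: "near x y" and x: "x \<in> hom E T A" and y: "y \<in> hom E T A"
    and x': "x' \<in> hom E T B" and y': "y' \<in> hom E T B"
    and e: "\<And>U t. t \<in> hom E U T \<Longrightarrow> x \<cdot> t = y \<cdot> t \<Longrightarrow> x' \<cdot> t = y' \<cdot> t"
  shows "near x' y'"
  unfolding near_iff[OF x']
proof (rule near_modal[OF n x y])
  show "eq_arr E B \<cdot> pairing E x' y' \<in> hom E T (Om E)" using x' y' by (simp add: hom_iff)
  fix U t assume t: "t \<in> hom E U T" and "x \<cdot> t = y \<cdot> t"
  then have eq: "x' \<cdot> t = y' \<cdot> t" by (rule e)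
  have h: "x' \<cdot> t \<in> hom E U B" "y' \<cdot> t \<in> hom E U B" using x' y' t by (auto simp: hom_iff)
  show "(eq_arr E B \<cdot> pairing E x' y') \<cdot> t = true_on E U"
    using eq_arr_true[OF h] eq x' y' t by (simp add: hom_iff)
qed

lemma near_sym: "near x y \<Longrightarrow> x \<in> hom E T A \<Longrightarrow> y \<in> hom E T A \<Longrightarrow> near y x"
  by (rule near_map[of x y T A y A x]) auto

lemma near_arr:
  assumes "near x y" "x \<in> hom E T A" "y \<in> hom E T A" "f \<in> hom E A B"
  shows "near (f \<cdot> x) (f \<cdot> y)"
  by (rule near_map[OF assms(1-3)]) (use assms in \<open>auto simp: hom_iff\<close>)

lemma near_trans:
  assumes xy: "near x y" and yz: "near y z"
    and x: "x \<in> hom E T A" and y: "y \<in> hom E T A" and z: "z \<in> hom E T A"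
  shows "near x z"
  unfolding near_iff[OF x]
proof (rule modal_idem)
  show e: "eq_arr E A \<cdot> pairing E x z \<in> hom E T (Om E)" using x z by (simp add: hom_iff)
  show "\<mu> \<cdot> (\<mu> \<cdot> (eq_arr E A \<cdot> pairing E x z)) = true_on E T"
  \<comment> \<open>Where \<open>y\<close> and \<open>z\<close> agree, \<open>near x y\<close>
    already reads \<open>near x z\<close>; the principle puts a second \<open>\<mu>\<close> in front
    of it.\<close>
  proof (rule near_modal[OF yz y z])
    show "\<mu> \<cdot> (eq_arr E A \<cdot> pairing E x z) \<in> hom E T (Om E)" using e by (simp add: hom_iff)
    fix U t assume t: "t \<in> hom E U T" and yzt: "y \<cdot> t = z \<cdot> t"
    have xt: "x \<cdot> t \<in> hom E U A" using x t by (simp add: hom_iff)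
    have "near (x \<cdot> t) (z \<cdot> t)" using near_comp[OF xy x y t] yzt by simp
    then show "(\<mu> \<cdot> (eq_arr E A \<cdot> pairing E x z)) \<cdot> t = true_on E U"
      unfolding near_iff[OF xt] using x z t by (simp add: hom_iff)
  qed
qed

text \<open>
  The proof passes from \<open>x\<close> to \<open>y\<close> by changing one component at a time, through the element \<open>w\<close>
  with the first component of \<open>x\<close> and the second one of \<open>y\<close>.
\<close>

lemma near_product:
  assumes P: "is_product E P p q A B" and x: "x \<in> hom E T P" and y: "y \<in> hom E T P"
    and n: "near (p \<cdot> x) (p \<cdot> y)" "near (q \<cdot> x) (q \<cdot> y)"
  shows "near x y"
proof -
  have p: "p \<in> hom E P A" and q: "q \<in> hom E P B" using P by (auto simp: is_product_def)
  have u: "h = h'" if "h \<in> hom E U P" "h' \<in> hom E U P" "p \<cdot> h = p \<cdot> h'" "q \<cdot> h = q \<cdot> h'" for U h h'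
  proof -
    have "p \<cdot> h' \<in> hom E U A" "q \<cdot> h' \<in> hom E U B" using that p q by (auto simp: hom_iff)
    then show ?thesis using P that unfolding is_product_def by blast
  qed
  have h: "p \<cdot> x \<in> hom E T A" "q \<cdot> x \<in> hom E T B" "p \<cdot> y \<in> hom E T A" "q \<cdot> y \<in> hom E T B"
    using p q x y by (auto simp: hom_iff)
  then obtain w where w: "w \<in> hom E T P" "p \<cdot> w = p \<cdot> x" "q \<cdot> w = q \<cdot> y"
    using P unfolding is_product_def by blast
  have c: "p \<cdot> (v \<cdot> t) = (p \<cdot> v) \<cdot> t" "q \<cdot> (v \<cdot> t) = (q \<cdot> v) \<cdot> t" "v \<cdot> t \<in> hom E U P"
    if "v \<in> hom E T P" "t \<in> hom E U T" for U v t
    using that p q by (auto simp: hom_iff)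
  \<comment> \<open>Where the second components of \<open>x\<close> and \<open>y\<close> agree,
    \<open>x\<close> and \<open>w\<close> have equal projections and so coincide by
    \<open>u\<close>; hence \<open>near_map\<close> applies to the second components.\<close>
  have "near x w"
    by (rule near_map[OF n(2) h(2,4) x w(1)]) (rule u[OF c(3)[OF x] c(3)[OF w(1)]], auto simp: c x w)
  moreover have "near w y"
    by (rule near_map[OF n(1) h(1,3) w(1) y]) (rule u[OF c(3)[OF w(1)] c(3)[OF y]], auto simp: c y w)
  ultimately show ?thesis using near_trans x y w(1) by blast
qed

section \<open>The internal relation and its forcing clause\<close>

lemma modal_rel_eq:
  "modal_rel E \<mu> X = SetOf 2 (ProdObj E X X) (Exists E 0 X (Exists E 1 X
     (And (Eq (Var 2) (PairT (Var 0) (Var 1))) (App \<mu> (Eq (Var 0) (Var 1))))))"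
  \<comment> \<open>The body contains only the variables 0 and 1, so the fresh variable of
    \<open>SetOfPairs\<close> is 2.\<close>
  by (simp add: modal_rel_def SetOfPairs_def numeral_2_eq_2)

context
  fixes X
  assumes X: "X \<in> Obj E"
begin

abbreviation rel_body :: "('o, 'a) tm" where
  "rel_body \<equiv> And (Eq (Var 2) (PairT (Var 0) (Var 1))) (App \<mu> (Eq (Var 0) (Var 1)))"

lemma has_type_body: "has_type E ((1, X) # (0, X) # (2, ProdObj E X X) # G) rel_body (Om E)"
  by (rule has_type_And[OF has_type.intros(6)[OF has_type.intros(1) has_type.intros(4)[OF
        has_type.intros(1) has_type.intros(1)]] has_type.intros(3)[OF _ has_type.intros(6)[OF
        has_type.intros(1) has_type.intros(1)]]])
    (auto simp: hom_iff)

lemma has_type_body_Exists: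
  assumes "wf_ctx E G"
  shows "has_type E ((0, X) # (2, ProdObj E X X) # G) (Exists E 1 X rel_body) (Om E)"
    "has_type E ((2, ProdObj E X X) # G) (Exists E 0 X (Exists E 1 X rel_body)) (Om E)"
  using X assms by (auto intro!: has_type_Exists has_type_body[simplified])

text \<open>The relation is a closed term that occurs in several contexts; typing and forcing are
  proved over an arbitrary tail \<open>G\<close> instead of being transported from the empty
  context.\<close>

lemma has_type_modal_rel:
  "wf_ctx E G \<Longrightarrow> has_type E G (modal_rel E \<mu> X) (PowObj E (ProdObj E X X))"
  unfolding modal_rel_eq using X by (intro has_type.intros has_type_body_Exists) auto

lemma forces_body:
  assumes wf: "wf_ctx E G" and t: "t \<in> hom E T (ctx_obj E G)" and a: "a \<in> hom E T X"
    and b: "b \<in> hom E T X" and p: "p \<in> hom E T (ProdObj E X X)"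
  shows "forces ((1, X) # (0, X) # (2, ProdObj E X X) # G)
      (pairing E b (pairing E a (pairing E p t))) rel_body \<longleftrightarrow> p = pairing E a b \<and> near a b"
proof -
  let ?G = "(1, X) # (0, X) # (2, ProdObj E X X) # G"
  let ?t = "pairing E b (pairing E a (pairing E p t))"
  have wfG: "wf_ctx E ?G" using wf X by simp
  have tG: "?t \<in> hom E T (ctx_obj E ?G)" using assms X by (auto simp: hom_iff)
  have v: "has_type E ?G (Var 2) (ProdObj E X X)" "has_type E ?G (PairT (Var 0) (Var 1)) (ProdObj E X X)"
    by (auto intro!: has_type.intros)
  have e: "has_type E ?G (App \<mu> (Eq (Var 0) (Var 1))) (Om E)"
    by (rule has_type.intros(3)[OF _ has_type.intros(6)[OF has_type.intros(1) has_type.intros(1)]])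
      (auto simp: hom_iff)
  have "forces ?G ?t (Eq (Var 2) (PairT (Var 0) (Var 1))) \<longleftrightarrow> p = pairing E a b"
    unfolding forces_Eq[OF v wfG tG] using assms X by (simp add: hom_iff)
  moreover have "forces ?G ?t (App \<mu> (Eq (Var 0) (Var 1))) \<longleftrightarrow> near a b"
    unfolding near_iff[OF a] forces_def using assms X by (simp add: hom_iff)
  ultimately show ?thesis using forces_And[OF has_type.intros(6)[OF v] e wfG tG] by simp
qed

text \<open>The bridge from syntax to generalized elements: afterwards the meaning of the relation
  enters only through \<open>near\<close>.\<close>

lemma forces_Mem_modal_rel:
  assumes s: "has_type E G s X" and u: "has_type E G u X" and wf: "wf_ctx E G"
    and t: "t \<in> hom E T (ctx_obj E G)"
  shows "forces G t (Mem (PairT s u) (modal_rel E \<mu> X)) \<longleftrightarrow> near (sem E G s \<cdot> t) (sem E G u \<cdot> t)"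
proof -
  let ?XX = "ProdObj E X X"
  let ?a = "sem E G s \<cdot> t" and ?b = "sem E G u \<cdot> t"
  let ?p = "pairing E ?a ?b"
  let ?G2 = "(2, ?XX) # G" and ?G0 = "(0, X) # (2, ?XX) # G" and ?G1 = "(1, X) # (0, X) # (2, ?XX) # G"
  have XX: "?XX \<in> Obj E" using X by simp
  have wf2: "wf_ctx E ?G2" and wf0: "wf_ctx E ?G0" using X wf by auto
  note ty = has_type_body_Exists[OF wf]
  have ss: "sem E G s \<in> hom E (ctx_obj E G) X" "sem E G u \<in> hom E (ctx_obj E G) X"
    using sem_hom s u wf by auto
  have ab: "?a \<in> hom E T X" "?b \<in> hom E T X" using ss t by (auto simp: hom_iff)
  have pt: "pairing E ?p t \<in> hom E T (ctx_obj E ?G2)" using ab t X by (auto simp: hom_iff)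
  have apt: "pairing E ?a (pairing E ?p t) \<in> hom E T (ctx_obj E ?G0)" using ab t X by (auto simp: hom_iff)
  have "sem E G (PairT s u) \<cdot> t = ?p" using ss t by (simp add: hom_iff)
  then have "forces G t (Mem (PairT s u) (modal_rel E \<mu> X)) \<longleftrightarrow>
      forces ?G2 (pairing E ?p t) (Exists E 0 X (Exists E 1 X rel_body))" (is "_ \<longleftrightarrow> ?F")
    unfolding modal_rel_eq
    using forces_Mem_SetOf[OF has_type.intros(4)[OF s u] ty(2) XX wf t] by simp
  also have "?F \<longleftrightarrow> near ?a ?b"
  proof
    assume n: "near ?a ?b"
    have "?p \<in> hom E T ?XX" using ab by (auto simp: hom_iff)
    from forces_body[OF wf t ab this] n
    have "forces ?G1 (pairing E ?b (pairing E ?a (pairing E ?p t))) rel_body" by simp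
    then have "forces ?G0 (pairing E ?a (pairing E ?p t)) (Exists E 1 X rel_body)"
      by (rule forces_ExistsI[OF has_type_body wf0 apt ab(2)])
    then show ?F by (rule forces_ExistsI[OF ty(1) wf2 pt ab(1)])
  next
    assume f: ?F
    \<comment> \<open>The existential quantifiers eliminate only into truth values, and nearness of
      \<open>?a\<close> and \<open>?b\<close> is the truth of one.\<close>
    have \<omega>: "\<mu> \<cdot> (eq_arr E X \<cdot> ?p) \<in> hom E T (Om E)" using ab by (auto simp: hom_iff)
    have "\<mu> \<cdot> (eq_arr E X \<cdot> ?p) = true_on E T"
    proof (rule forces_ExistsD[OF f ty(1) X wf2 pt \<omega>])
      fix U r c assume r: "r \<in> hom E U T" and c: "c \<in> hom E U X"
        and f: "forces ?G0 (pairing E c (pairing E ?p t \<cdot> r)) (Exists E 1 X rel_body)"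
      have h: "pairing E c (pairing E ?p t \<cdot> r) \<in> hom E U (ctx_obj E ?G0)"
        using pt c r X wf by (auto simp: hom_iff)
      have \<omega>r: "(\<mu> \<cdot> (eq_arr E X \<cdot> ?p)) \<cdot> r \<in> hom E U (Om E)" using \<omega> r by (simp add: hom_iff)
      show "(\<mu> \<cdot> (eq_arr E X \<cdot> ?p)) \<cdot> r = true_on E U"
      proof (rule forces_ExistsD[OF f has_type_body X wf0 h \<omega>r])
        fix V s d assume s: "s \<in> hom E V U" and d: "d \<in> hom E V X"
          and f: "forces ?G1 (pairing E d (pairing E c (pairing E ?p t \<cdot> r) \<cdot> s)) rel_body"
        have rs: "r \<cdot> s \<in> hom E V T" using r s by (simp add: hom_iff)
        have l: "t \<cdot> (r \<cdot> s) \<in> hom E V (ctx_obj E G)" "c \<cdot> s \<in> hom E V X" "?p \<cdot> (r \<cdot> s) \<in> hom E V ?XX"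
          using r s t c d ab by (auto simp: hom_iff)
        have "pairing E c (pairing E ?p t \<cdot> r) \<cdot> s = pairing E (c \<cdot> s) (pairing E (?p \<cdot> (r \<cdot> s)) (t \<cdot> (r \<cdot> s)))"
          using r s t c ab by (auto simp: hom_iff)
        \<comment> \<open>The witnesses are the components of \<open>?p\<close> at the later stage,
          so their nearness is the truth of the goal restricted along
          \<open>r \<cdot> s\<close>.\<close>
        then have e: "?p \<cdot> (r \<cdot> s) = pairing E (c \<cdot> s) d" "near (c \<cdot> s) d"
          using f forces_body[OF wf l(1,2) d l(3)] by auto
        have "((\<mu> \<cdot> (eq_arr E X \<cdot> ?p)) \<cdot> r) \<cdot> s = \<mu> \<cdot> (eq_arr E X \<cdot> (?p \<cdot> (r \<cdot> s)))"
          using ab r s X by (simp add: hom_iff)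
        also have "\<dots> = true_on E V" using e near_iff[OF l(2)] by simp
        finally show "((\<mu> \<cdot> (eq_arr E X \<cdot> ?p)) \<cdot> r) \<cdot> s = true_on E V" .
      qed
    qed
    then show "near ?a ?b" using near_iff[OF ab(1)] by simp
  qed
  finally show ?thesis .
qed


text \<open>Once the forcing clauses are unfolded, each axiom is a property of \<open>near\<close>
  at an arbitrary stage.\<close>

lemma equivalence_relation_modal_rel: "equivalence_relation E X (modal_rel E \<mu> X)"
proof -
  let ?R = "modal_rel E \<mu> X"
  let ?r = "\<lambda>i j. Mem (PairT (Var i) (Var j)) ?R"
  let ?G0 = "[(0::nat, X)]" and ?G1 = "[(1::nat, X), (0, X)]" and ?G2 = "[(2::nat, X), (1, X), (0, X)]"
  have wf: "wf_ctx E ?G0" "wf_ctx E ?G1" "wf_ctx E ?G2" using X by auto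
  have ty: "has_type E G (?r i j) (Om E)" if "wf_ctx E G" "map_of G i = Some X" "map_of G j = Some X" for G i j
    by (rule has_type.intros(7)[OF has_type.intros(4)[OF has_type.intros(1)[OF that(2)]
          has_type.intros(1)[OF that(3)]] has_type_modal_rel[OF that(1)]])
  note F = has_type_Forall[OF X] and I = has_type_Imp and A = has_type_And
  have refl: "has_type E [] (Forall 0 X (?r 0 0)) (Om E)"
    by (rule F, rule ty) (auto simp: X)
  have sym1: "has_type E ?G0 (Forall 1 X (Imp (?r 0 1) (?r 1 0))) (Om E)"
    by (intro F I ty) (auto simp: X)
  have trans2: "has_type E ?G2 (And (?r 0 1) (?r 1 2)) (Om E)" by (intro A ty) (auto simp: X)
  have trans1: "has_type E ?G1 (Forall 2 X (Imp (And (?r 0 1) (?r 1 2)) (?r 0 2))) (Om E)"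
    by (intro F I A ty) (auto simp: X)
  have trans0: "has_type E ?G0 (Forall 1 X (Forall 2 X (Imp (And (?r 0 1) (?r 1 2)) (?r 0 2)))) (Om E)"
    by (rule F[OF trans1])
  have i: "Ide E (One E) \<in> hom E (One E) (ctx_obj E [])" by (simp add: hom_iff)
  have b: "Ide E (One E) \<cdot> r = bang E U" if "r \<in> hom E U (One E)" for U r
    using Ide_left[OF that] bang_unique[OF that] by simp
  have c0: "pairing E a (bang E U) \<in> hom E U (ctx_obj E ?G0)" if "a \<in> hom E U X" for U a
    using that by (auto simp: hom_iff)
  have c1: "pairing E b (pairing E a (bang E U)) \<in> hom E U (ctx_obj E ?G1)"
    if "a \<in> hom E U X" "b \<in> hom E U X" for U a b
    using that by (auto simp: hom_iff)
  have c2: "pairing E c (pairing E b (pairing E a (bang E U))) \<in> hom E U (ctx_obj E ?G2)"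
    if "a \<in> hom E U X" "b \<in> hom E U X" "c \<in> hom E U X" for U a b c
    using that by (auto simp: hom_iff)
  have d: "pairing E a (bang E U) \<cdot> r = pairing E (a \<cdot> r) (bang E V)"
    "pairing E b (pairing E a (bang E U)) \<cdot> r = pairing E (b \<cdot> r) (pairing E (a \<cdot> r) (bang E V))"
    "a \<cdot> r \<in> hom E V X"
    if "a \<in> hom E U X" "b \<in> hom E U X" "r \<in> hom E V U" for U V a b r
    using that by (auto simp: hom_iff)
  have mem: "forces G t (?r i j) \<longleftrightarrow> near (var_arr E G i \<cdot> t) (var_arr E G j \<cdot> t)"
    if "wf_ctx E G" "map_of G i = Some X" "map_of G j = Some X" "t \<in> hom E T (ctx_obj E G)" for G t T i j
    using forces_Mem_modal_rel[OF has_type.intros(1) has_type.intros(1) that(1,4)] that(2,3) by simp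
  have m0: "forces ?G0 (pairing E a (bang E U)) (?r 0 0) \<longleftrightarrow> near a a" if "a \<in> hom E U X" for U a
    using mem[OF wf(1) _ _ c0[OF that]] that by (simp add: hom_iff)
  have m1: "forces ?G1 (pairing E b (pairing E a (bang E U))) (?r 0 1) \<longleftrightarrow> near a b"
    "forces ?G1 (pairing E b (pairing E a (bang E U))) (?r 1 0) \<longleftrightarrow> near b a"
    if "a \<in> hom E U X" "b \<in> hom E U X" for U a b
    using mem[OF wf(2) _ _ c1[OF that]] that by (simp_all add: hom_iff)
  have m2: "forces ?G2 (pairing E c (pairing E b (pairing E a (bang E U)))) (?r 0 1) \<longleftrightarrow> near a b"
    "forces ?G2 (pairing E c (pairing E b (pairing E a (bang E U)))) (?r 1 2) \<longleftrightarrow> near b c"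
    "forces ?G2 (pairing E c (pairing E b (pairing E a (bang E U)))) (?r 0 2) \<longleftrightarrow> near a c"
    if "a \<in> hom E U X" "b \<in> hom E U X" "c \<in> hom E U X" for U a b c
    using mem[OF wf(3) _ _ c2[OF that]] that by (simp_all add: hom_iff)
  have ty0: "has_type E ?G0 (?r 0 0) (Om E)"
    using wf(1) by (auto intro!: ty)
  have ty1: "has_type E ?G1 (?r 0 1) (Om E)" "has_type E ?G1 (?r 1 0) (Om E)"
    using wf(2) by (auto intro!: ty)
  have ty2: "has_type E ?G2 (?r 0 1) (Om E)" "has_type E ?G2 (?r 1 2) (Om E)" "has_type E ?G2 (?r 0 2) (Om E)"
    using wf(3) by (auto intro!: ty)
  have "holds E (Forall 0 X (?r 0 0))"
    unfolding holds_iff_forces[OF refl] forces_Forall[OF ty0 X wf_ctx_simps(1) i]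
    using m0 b near_refl by simp
  moreover have "holds E (Forall 0 X (Forall 1 X (Imp (?r 0 1) (?r 1 0))))"
    unfolding holds_iff_forces[OF F[OF sym1]] forces_Forall[OF sym1 X wf_ctx_simps(1) i]
  proof (intro allI impI)
    fix U r a assume r: "r \<in> hom E U (One E)" and a: "a \<in> hom E U X"
    show "forces ?G0 (pairing E a (Ide E (One E) \<cdot> r)) (Forall 1 X (Imp (?r 0 1) (?r 1 0)))"
      unfolding b[OF r] forces_Forall_Imp[OF ty1 X wf(1) c0[OF a]]
    proof (intro allI impI)
      fix V s y assume s: "s \<in> hom E V U" and y: "y \<in> hom E V X"
      have as: "a \<cdot> s \<in> hom E V X" using a s by (simp add: hom_iff)
      show "forces ?G1 (pairing E y (pairing E a (bang E U) \<cdot> s)) (?r 1 0)"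
        if "forces ?G1 (pairing E y (pairing E a (bang E U) \<cdot> s)) (?r 0 1)"
        using that near_sym[OF _ as y] unfolding d(1)[OF a a s] m1[OF as y] by blast
    qed
  qed
  moreover have "holds E (Forall 0 X (Forall 1 X (Forall 2 X (Imp (And (?r 0 1) (?r 1 2)) (?r 0 2)))))"
    unfolding holds_iff_forces[OF F[OF trans0]] forces_Forall[OF trans0 X wf_ctx_simps(1) i]
  proof (intro allI impI)
    fix U r a assume r: "r \<in> hom E U (One E)" and a: "a \<in> hom E U X"
    show "forces ?G0 (pairing E a (Ide E (One E) \<cdot> r))
        (Forall 1 X (Forall 2 X (Imp (And (?r 0 1) (?r 1 2)) (?r 0 2))))"
      unfolding b[OF r] forces_Forall[OF trans1 X wf(1) c0[OF a]]
    proof (intro allI impI)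
      fix V s y assume s: "s \<in> hom E V U" and y: "y \<in> hom E V X"
      have as: "a \<cdot> s \<in> hom E V X" using a s by (simp add: hom_iff)
      show "forces ?G1 (pairing E y (pairing E a (bang E U) \<cdot> s))
          (Forall 2 X (Imp (And (?r 0 1) (?r 1 2)) (?r 0 2)))"
        unfolding d(1)[OF a a s] forces_Forall_Imp[OF trans2 ty2(3) X wf(2) c1[OF as y]]
      proof (intro allI impI)
        fix W v z assume v: "v \<in> hom E W V" and z: "z \<in> hom E W X"
        note xyz = d(3)[OF as as v] d(3)[OF y y v] z
        show "forces ?G2 (pairing E z (pairing E y (pairing E (a \<cdot> s) (bang E V)) \<cdot> v)) (?r 0 2)"
          if "forces ?G2 (pairing E z (pairing E y (pairing E (a \<cdot> s) (bang E V)) \<cdot> v))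
            (And (?r 0 1) (?r 1 2))"
          using that near_trans[OF _ _ xyz]
          unfolding d(2)[OF as y v] forces_And[OF ty2(1,2) wf(3) c2[OF xyz]] m2[OF xyz] by blast
      qed
    qed
  qed
  ultimately show ?thesis
    unfolding equivalence_relation_def using has_type_modal_rel[OF wf_ctx_simps(1)] by blast
qed

section \<open>Equivalence classes and the quotient map\<close>

definition class_arr :: 'a where
  "class_arr = arrow_of E 0 X (eq_class X (modal_rel E \<mu> X))"

lemma has_type_class_mem:
  assumes "wf_ctx E G" "map_of G 0 = Some X"
  shows "has_type E ((1, X) # G) (Mem (PairT (Var 0) (Var 1)) (modal_rel E \<mu> X)) (Om E)"
  by (rule has_type.intros(7)[OF has_type.intros(4)[OF has_type.intros(1) has_type.intros(1)]
        has_type_modal_rel]) (use assms X in auto)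

lemma has_type_eq_class:
  assumes "wf_ctx E G" "map_of G 0 = Some X"
  shows "has_type E G (eq_class X (modal_rel E \<mu> X)) (PowObj E X)"
  unfolding eq_class_def by (rule has_type.intros(5)[OF X has_type_class_mem[OF assms]])

text \<open>Two contexts are needed because \<open>C(x)\<close> is interpreted alone in
  \<open>class_arr\<close> but next to set variables inside the quotient set. Extensionality reduces
  the equation to having the same near elements.\<close>

lemma sem_eq_class_eq_iff:
  assumes G: "wf_ctx E G" "map_of G 0 = Some X" and H: "wf_ctx E H" "map_of H 0 = Some X"
    and t: "t \<in> hom E T (ctx_obj E G)" and u: "u \<in> hom E T (ctx_obj E H)"
  shows "sem E G (eq_class X (modal_rel E \<mu> X)) \<cdot> t = sem E H (eq_class X (modal_rel E \<mu> X)) \<cdot> u \<longleftrightarrow>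
    near (var_arr E G 0 \<cdot> t) (var_arr E H 0 \<cdot> u)"
proof -
  let ?M = "Mem (PairT (Var 0) (Var 1)) (modal_rel E \<mu> X)"
  have ty: "sem E ((1, X) # K) ?M \<in> hom E (ProdObj E X (ctx_obj E K)) (Om E)"
    if "wf_ctx E K" "map_of K 0 = Some X" for K
    using sem_hom[OF has_type_class_mem[OF that]] that(1) X by simp
  have fo: "sem E ((1, X) # K) ?M \<cdot> pairing E y (s \<cdot> r) = true_on E U \<longleftrightarrow> near ((var_arr E K 0 \<cdot> s) \<cdot> r) y"
    if K: "wf_ctx E K" "map_of K 0 = Some X" and s: "s \<in> hom E T (ctx_obj E K)" and r: "r \<in> hom E U T"
      and y: "y \<in> hom E U X" for K s U r y
  proof -
    have w: "wf_ctx E ((1, X) # K)" using K X by simp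
    have p: "pairing E y (s \<cdot> r) \<in> hom E U (ctx_obj E ((1, X) # K))"
      using s r y K X by (auto simp: hom_iff)
    have v: "has_type E ((1, X) # K) (Var 0) X" "has_type E ((1, X) # K) (Var 1) X"
      using K by (auto intro!: has_type.intros)
    show ?thesis
      using forces_Mem_modal_rel[OF v w p] var_arr_hom[OF K] s r y K X
      by (simp add: forces_def hom_iff)
  qed
  let ?x = "var_arr E G 0 \<cdot> t" and ?y = "var_arr E H 0 \<cdot> u"
  have x: "?x \<in> hom E T X" and y: "?y \<in> hom E T X"
    using var_arr_hom[OF G] var_arr_hom[OF H] t u by (auto simp: hom_iff)
  have "sem E G (eq_class X (modal_rel E \<mu> X)) \<cdot> t = sem E H (eq_class X (modal_rel E \<mu> X)) \<cdot> u \<longleftrightarrow>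
      (\<forall>U r a. r \<in> hom E U T \<longrightarrow> a \<in> hom E U X \<longrightarrow> (near (?x \<cdot> r) a \<longleftrightarrow> near (?y \<cdot> r) a))" (is "_ \<longleftrightarrow> ?P")
    unfolding eq_class_def sem.simps(5) transpose_eq_iff[OF ty[OF G] ty[OF H] t u X]
    using fo[OF G t] fo[OF H u] by simp
  also have "?P \<longleftrightarrow> near ?x ?y"
  proof
    assume P: ?P
    \<comment> \<open>The test element is \<open>?y\<close> at the identity stage: \<open>?y\<close>
      is near itself, hence \<open>?x\<close> is near it.\<close>
    have "Ide E T \<in> hom E T T" "?x \<cdot> Ide E T = ?x" "?y \<cdot> Ide E T = ?y" using x y by (auto simp: hom_iff)
    then show "near ?x ?y" using P y near_refl[OF y] by metis
  next
    assume n: "near ?x ?y"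
    show ?P
    proof (intro allI impI)
      fix U r a assume r: "r \<in> hom E U T" and a: "a \<in> hom E U X"
      have h: "?x \<cdot> r \<in> hom E U X" "?y \<cdot> r \<in> hom E U X" using x y r by (auto simp only: hom_iff comp_simps)
      have "near (?x \<cdot> r) (?y \<cdot> r)" by (rule near_comp[OF n x y r])
      then show "near (?x \<cdot> r) a \<longleftrightarrow> near (?y \<cdot> r) a"
        using near_trans near_sym h a by meson
    qed
  qed
  finally show ?thesis .
qed

lemma class_arr_hom: "class_arr \<in> hom E X (PowObj E X)"
  and class_arr_comp: "x \<in> hom E T X \<Longrightarrow>
    class_arr \<cdot> x = sem E [(0, X)] (eq_class X (modal_rel E \<mu> X)) \<cdot> pairing E x (bang E T)"
proof -
  have "sem E [(0, X)] (eq_class X (modal_rel E \<mu> X)) \<in> hom E (ProdObj E X (One E)) (PowObj E X)"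
    using sem_hom[OF has_type_eq_class, of "[(0, X)]"] X by simp
  then show "class_arr \<in> hom E X (PowObj E X)" "x \<in> hom E T X \<Longrightarrow>
    class_arr \<cdot> x = sem E [(0, X)] (eq_class X (modal_rel E \<mu> X)) \<cdot> pairing E x (bang E T)"
    using X by (auto simp: class_arr_def arrow_of_def hom_iff)
qed

lemma sem_eq_class:
  assumes G: "wf_ctx E G" "map_of G 0 = Some X" and t: "t \<in> hom E T (ctx_obj E G)"
  shows "sem E G (eq_class X (modal_rel E \<mu> X)) \<cdot> t = class_arr \<cdot> (var_arr E G 0 \<cdot> t)"
proof -
  let ?x = "var_arr E G 0 \<cdot> t"
  have x: "?x \<in> hom E T X" using var_arr_hom[OF G] t by (simp add: hom_iff)
  have w: "wf_ctx E [(0, X)]" "map_of [(0, X)] 0 = Some X" using X by auto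
  have p: "pairing E ?x (bang E T) \<in> hom E T (ctx_obj E [(0, X)])"
    using x by (auto simp only: hom_iff ctx_obj.simps pairing_simps bang_simps Prod_simps One_Obj)
  have "var_arr E [(0, X)] 0 \<cdot> pairing E y (bang E T) = y" if "y \<in> hom E T X" for y
    using that X by (simp add: hom_iff)
  from this[OF x] show ?thesis
    unfolding class_arr_comp[OF x] sem_eq_class_eq_iff[OF G w t p] using near_refl[OF x] by simp
qed

lemma class_arr_eq_iff:
  assumes x: "x \<in> hom E T X" and y: "y \<in> hom E T X"
  shows "class_arr \<cdot> x = class_arr \<cdot> y \<longleftrightarrow> near x y"
proof -
  have w: "wf_ctx E [(0, X)]" "map_of [(0, X)] 0 = Some X" using X by auto
  have p: "pairing E x (bang E T) \<in> hom E T (ctx_obj E [(0, X)])"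
    "pairing E y (bang E T) \<in> hom E T (ctx_obj E [(0, X)])"
    using x y by (auto simp: hom_iff)
  show ?thesis
    unfolding class_arr_comp[OF x] class_arr_comp[OF y] sem_eq_class_eq_iff[OF w w p]
    using x y by (simp add: hom_iff)
qed

text \<open>The formula that defines the quotient set expresses membership in the image of
  \<open>class_arr\<close>, so \<open>image_cover\<close> factors \<open>class_arr\<close> through
  the inclusion; the covering factor will be the quotient map.\<close>

lemma quotient_image:
  "quotient_incl E X (modal_rel E \<mu> X) \<in> hom E (modal_quotient E \<mu> X) (PowObj E X)" (is ?A)
  "is_monic E (quotient_incl E X (modal_rel E \<mu> X))" (is ?B)
  "\<exists>p. p \<in> hom E X (modal_quotient E \<mu> X) \<and>
    quotient_incl E X (modal_rel E \<mu> X) \<cdot> p = class_arr \<and> cover p" (is ?C)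
proof -
  let ?P = "PowObj E X"
  let ?cl = "eq_class X (modal_rel E \<mu> X)"
  let ?S = "quotient_set E X (modal_rel E \<mu> X)"
  \<comment> \<open>Unfolding membership of variable 0 in the comprehension adds its value again as
    variable 2, so a point \<open>y\<close> occurs twice in \<open>?G2\<close> and
    \<open>?H\<close>.\<close>
  let ?G = "[(0::nat, ?P)]" and ?G2 = "[(2::nat, ?P), (0, ?P)]" and ?H = "[(0::nat, X), (2, ?P), (0, ?P)]"
  have wf: "wf_ctx E ?G" "wf_ctx E ?G2" "wf_ctx E ?H" using X by auto
  have P: "?P \<in> Obj E" using X by simp
  have v: "has_type E ?H (Var 2) ?P" "has_type E ?H ?cl ?P"
    by (auto intro!: has_type.intros has_type_eq_class simp: X)
  have eq: "has_type E ?H (Eq (Var 2) ?cl) (Om E)" by (rule has_type.intros(6)[OF v])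
  have ex: "has_type E ?G2 (Exists E 0 X (Eq (Var 2) ?cl)) (Om E)"
    by (rule has_type_Exists[OF eq wf(2) X])
  have S: "has_type E ?G ?S (PowObj E ?P)"
    unfolding quotient_set_def by (rule has_type.intros(5)[OF P ex])
  have v0: "has_type E ?G (Var 0) ?P" by (auto intro!: has_type.intros)
  let ?\<chi> = "arrow_of E 0 ?P (Mem (Var 0) ?S)"
  have s: "sem E ?G (Mem (Var 0) ?S) \<in> hom E (ProdObj E ?P (One E)) (Om E)"
    using sem_hom[OF has_type.intros(7)[OF v0 S] wf(1)] by simp
  then have \<chi>: "?\<chi> \<in> hom E ?P (Om E)" using X by (simp add: arrow_of_def hom_iff)
  have g: "pairing E y (bang E T) \<in> hom E T (ctx_obj E ?G)" if "y \<in> hom E T ?P" for T y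
    using that X by (auto simp: hom_iff)
  have g2: "pairing E y (pairing E y (bang E T)) \<in> hom E T (ctx_obj E ?G2)" if "y \<in> hom E T ?P" for T y
    using that X by (auto simp: hom_iff)
  have gh: "pairing E x (pairing E y (pairing E y (bang E T))) \<in> hom E T (ctx_obj E ?H)"
    if "x \<in> hom E T X" "y \<in> hom E T ?P" for T x y
    using that X by (auto simp: hom_iff)
  have \<chi>y: "?\<chi> \<cdot> y = true_on E T \<longleftrightarrow>
      forces ?G2 (pairing E y (pairing E y (bang E T))) (Exists E 0 X (Eq (Var 2) ?cl))"
    if y: "y \<in> hom E T ?P" for T y
  proof -
    have "?\<chi> \<cdot> y = true_on E T \<longleftrightarrow> forces ?G (pairing E y (bang E T)) (Mem (Var 0) ?S)"
      using y s X by (simp add: arrow_of_def forces_def hom_iff)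
    moreover have "sem E ?G (Var 0) \<cdot> pairing E y (bang E T) = y" using y X by (simp add: hom_iff)
    ultimately show ?thesis
      unfolding quotient_set_def using forces_Mem_SetOf[OF v0 ex P wf(1) g[OF y]] by simp
  qed
  have body: "forces ?H (pairing E x (pairing E y (pairing E y (bang E T)))) (Eq (Var 2) ?cl) \<longleftrightarrow>
      class_arr \<cdot> x = y" if x: "x \<in> hom E T X" and y: "y \<in> hom E T ?P" for T x y
  proof -
    have m: "map_of ?H 0 = Some X" by simp
    have e: "var_arr E ?H 0 \<cdot> pairing E x (pairing E y (pairing E y (bang E T))) = x"
      "sem E ?H (Var 2) \<cdot> pairing E x (pairing E y (pairing E y (bang E T))) = y"
      using x y X by (simp_all add: hom_iff)
    show ?thesis
      unfolding forces_Eq[OF v wf(3) gh[OF x y]] sem_eq_class[OF wf(3) m gh[OF x y]] e by auto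
  qed
  have i: "Ide E X \<in> hom E X X" using X by (simp add: hom_iff)
  have "class_arr \<cdot> Ide E X = class_arr" using class_arr_hom by (simp add: hom_iff)
  then have \<chi>c: "?\<chi> \<cdot> class_arr = true_on E X"
    unfolding \<chi>y[OF class_arr_hom]
    by (intro forces_ExistsI[OF eq wf(2) g2[OF class_arr_hom] i] body[OF i class_arr_hom, THEN iffD2])
  have incl: "Pb1 E ?\<chi> (Tru E) = quotient_incl E X (modal_rel E \<mu> X)"
    "Dom E (quotient_incl E X (modal_rel E \<mu> X)) = modal_quotient E \<mu> X"
    by (auto simp: quotient_incl_def inclusion_def modal_quotient_def quotient_obj_def)
  show ?A ?B using classified_subobject[OF \<chi>] unfolding incl by auto
  have "\<exists>p. p \<in> hom E X (Dom E (Pb1 E ?\<chi> (Tru E))) \<and> Pb1 E ?\<chi> (Tru E) \<cdot> p = class_arr \<and> cover p"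
  proof (rule image_cover[OF class_arr_hom \<chi> \<chi>c])
    fix T y \<omega> assume y: "y \<in> hom E T ?P" and t: "?\<chi> \<cdot> y = true_on E T" and \<omega>: "\<omega> \<in> hom E T (Om E)"
      and l: "\<And>U r x. r \<in> hom E U T \<Longrightarrow> x \<in> hom E U X \<Longrightarrow> class_arr \<cdot> x = y \<cdot> r \<Longrightarrow> \<omega> \<cdot> r = true_on E U"
    show "\<omega> = true_on E T"
    proof (rule forces_ExistsD[OF t[unfolded \<chi>y[OF y]] eq X wf(2) g2[OF y] \<omega>])
      fix U r a assume r: "r \<in> hom E U T" and a: "a \<in> hom E U X"
        and f: "forces ?H (pairing E a (pairing E y (pairing E y (bang E T)) \<cdot> r)) (Eq (Var 2) ?cl)"
      have yr: "y \<cdot> r \<in> hom E U ?P"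
        "pairing E y (pairing E y (bang E T)) \<cdot> r = pairing E (y \<cdot> r) (pairing E (y \<cdot> r) (bang E U))"
        using y r by (auto simp: hom_iff)
      show "\<omega> \<cdot> r = true_on E U" using l[OF r a] f body[OF a yr(1)] unfolding yr(2) by simp
    qed
  qed
  then show ?C unfolding incl .
qed

lemma is_quotient_map_unique:
  assumes "is_quotient_map E X (modal_rel E \<mu> X) p" "is_quotient_map E X (modal_rel E \<mu> X) q"
  shows "p = q"
  by (rule is_monicD[OF quotient_image(2) _ quotient_image(1)])
    (use assms in \<open>auto simp: is_quotient_map_def modal_quotient_def\<close>)

text \<open>The covering factor from \<open>quotient_image\<close> has the defining property, and
  uniqueness identifies it with the arrow described by \<open>THE\<close>.\<close>

lemma modal_quotient_map_spec:
  "is_quotient_map E X (modal_rel E \<mu> X) (modal_quotient_map E \<mu> X)" (is "is_quotient_map _ _ ?R ?q")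
  "cover (modal_quotient_map E \<mu> X)"
proof -
  obtain p where p: "p \<in> hom E X (modal_quotient E \<mu> X)" "quotient_incl E X ?R \<cdot> p = class_arr" "cover p"
    using quotient_image(3) by blast
  then have "is_quotient_map E X ?R p"
    by (simp add: is_quotient_map_def modal_quotient_def class_arr_def)
  moreover from this have "?q = p"
    unfolding modal_quotient_map_def quotient_map_def by (blast intro: is_quotient_map_unique)
  ultimately show "is_quotient_map E X ?R ?q" "cover ?q" using p by auto
qed

lemma modal_quotient_map_hom: "modal_quotient_map E \<mu> X \<in> hom E X (modal_quotient E \<mu> X)"
  using modal_quotient_map_spec(1) by (simp add: is_quotient_map_def modal_quotient_def)

text \<open>The inclusion into the power object is monic, so the kernel of the quotient map is that
  of \<open>class_arr\<close>.\<close>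

lemma modal_quotient_map_eq_iff:
  assumes x: "x \<in> hom E T X" and y: "y \<in> hom E T X"
  shows "modal_quotient_map E \<mu> X \<cdot> x = modal_quotient_map E \<mu> X \<cdot> y \<longleftrightarrow> near x y"
    (is "?q \<cdot> x = ?q \<cdot> y \<longleftrightarrow> _")
proof -
  let ?m = "quotient_incl E X (modal_rel E \<mu> X)"
  note q = modal_quotient_map_hom and m = quotient_image(1)
  have mq: "?m \<cdot> ?q = class_arr"
    using modal_quotient_map_spec(1) by (simp add: is_quotient_map_def class_arr_def)
  have h: "?q \<cdot> x \<in> hom E T (modal_quotient E \<mu> X)" "?q \<cdot> y \<in> hom E T (modal_quotient E \<mu> X)"
    using q x y by (auto simp: hom_iff)
  have "?m \<cdot> (?q \<cdot> z) = class_arr \<cdot> z" if "z \<in> hom E T X" for z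
    unfolding mq[symmetric] using m q that by (simp add: hom_iff)
  then have "?q \<cdot> x = ?q \<cdot> y \<longleftrightarrow> class_arr \<cdot> x = class_arr \<cdot> y"
    using is_monicD[OF quotient_image(2) _ m h] x y by metis
  then show ?thesis using class_arr_eq_iff[OF x y] by simp
qed

end

section \<open>The quotient functor\<close>

abbreviation Q :: "'o \<Rightarrow> 'o" where "Q \<equiv> modal_quotient E \<mu>"
abbreviation q :: "'o \<Rightarrow> 'a" where "q \<equiv> modal_quotient_map E \<mu>"

lemmas q_hom = modal_quotient_map_hom
  and q_cover = modal_quotient_map_spec(2)
  and q_eq_iff = modal_quotient_map_eq_iff

lemma Q_Obj: "X \<in> Obj E \<Longrightarrow> Q X \<in> Obj E"
  using q_hom[of X] by (simp add: hom_iff)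

definition Q_arr :: "'a \<Rightarrow> 'a" where
  "Q_arr f = (THE g. g \<in> hom E (Q (Dom E f)) (Q (Cod E f)) \<and> g \<cdot> q (Dom E f) = q (Cod E f) \<cdot> f)"

lemma Q_arr_unique:
  assumes "g \<cdot> q A = h \<cdot> q A" "A \<in> Obj E" "g \<in> hom E (Q A) Z" "h \<in> hom E (Q A) Z"
  shows "g = h"
  by (rule cover_epi[OF q_cover q_hom]) (use assms in auto)

text \<open>Arrows preserve \<open>near\<close>, so \<open>q B \<cdot> f\<close> respects the kernel
  of \<open>q A\<close> and descends. Covers are epic, which makes the descended arrow unique and
  \<open>THE\<close> meaningful.\<close>

lemma Q_arr_spec:
  assumes f: "f \<in> hom E A B"
  shows "Q_arr f \<in> hom E (Q A) (Q B)" "Q_arr f \<cdot> q A = q B \<cdot> f"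
proof -
  have A: "A \<in> Obj E" and B: "B \<in> Obj E" and d: "Dom E f = A" "Cod E f = B" using f by (auto simp: hom_iff)
  note qA = q_hom[OF A] and qB = q_hom[OF B]
  have qf: "q B \<cdot> f \<in> hom E A (Q B)" using f qB by (simp add: hom_iff)
  have "\<exists>g. g \<in> hom E (Q A) (Q B) \<and> g \<cdot> q A = q B \<cdot> f"
  proof (rule cover_descent[OF q_cover[OF A] qA qf])
    fix T x y assume x: "x \<in> hom E T A" and y: "y \<in> hom E T A" and e: "q A \<cdot> x = q A \<cdot> y"
    have "f \<cdot> x \<in> hom E T B" "f \<cdot> y \<in> hom E T B" using f x y by (auto simp: hom_iff)
    from q_eq_iff[OF B this] have "q B \<cdot> (f \<cdot> x) = q B \<cdot> (f \<cdot> y)"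
      using near_arr[OF _ x y f] e q_eq_iff[OF A x y] by simp
    then show "(q B \<cdot> f) \<cdot> x = (q B \<cdot> f) \<cdot> y" using qB f x y by (simp add: hom_iff)
  qed
  then have "\<exists>!g. g \<in> hom E (Q A) (Q B) \<and> g \<cdot> q A = q B \<cdot> f"
    using Q_arr_unique[OF _ A] by metis
  from theI'[OF this] show "Q_arr f \<in> hom E (Q A) (Q B)" "Q_arr f \<cdot> q A = q B \<cdot> f"
    unfolding Q_arr_def d by auto
qed

lemma Q_arr_Ide:
  assumes A: "A \<in> Obj E" shows "Q_arr (Ide E A) = Ide E (Q A)"
proof (rule Q_arr_unique[OF _ A])
  note i = Ide_hom[OF A]
  show "Q_arr (Ide E A) \<in> hom E (Q A) (Q A)" by (rule Q_arr_spec(1)[OF i])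
  show "Ide E (Q A) \<in> hom E (Q A) (Q A)" by (rule Ide_hom[OF Q_Obj[OF A]])
  show "Q_arr (Ide E A) \<cdot> q A = Ide E (Q A) \<cdot> q A"
    unfolding Q_arr_spec(2)[OF i] using q_hom[OF A] by (simp add: hom_iff)
qed

lemma Q_arr_comp:
  assumes f: "f \<in> hom E A B" and g: "g \<in> hom E B C"
  shows "Q_arr (g \<cdot> f) = Q_arr g \<cdot> Q_arr f"
proof -
  have o: "A \<in> Obj E" "B \<in> Obj E" "C \<in> Obj E" using f g by (auto simp: hom_iff)
  note gf = Comp_hom[OF f g] and q = o[THEN q_hom]
  note s = Q_arr_spec[OF f] Q_arr_spec[OF g]
  show ?thesis
  proof (rule Q_arr_unique[OF _ o(1)])
    show "Q_arr (g \<cdot> f) \<in> hom E (Q A) (Q C)" by (rule Q_arr_spec(1)[OF gf])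
    show "Q_arr g \<cdot> Q_arr f \<in> hom E (Q A) (Q C)" by (rule Comp_hom[OF s(1,3)])
    have "(Q_arr g \<cdot> Q_arr f) \<cdot> q A = (Q_arr g \<cdot> q B) \<cdot> f"
      unfolding Comp_assoc[OF q(1) s(1,3)] s(2) Comp_assoc[OF f q(2) s(3)] ..
    also have "\<dots> = Q_arr (g \<cdot> f) \<cdot> q A"
      unfolding s(4) Q_arr_spec(2)[OF gf] Comp_assoc[OF f g q(3)] ..
    finally show "Q_arr (g \<cdot> f) \<cdot> q A = (Q_arr g \<cdot> Q_arr f) \<cdot> q A" ..
  qed
qed

lemma Q_arr_q:
  assumes f: "f \<in> hom E A B" and x: "x \<in> hom E T A"
  shows "Q_arr f \<cdot> (q A \<cdot> x) = q B \<cdot> (f \<cdot> x)"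
proof -
  have o: "A \<in> Obj E" "B \<in> Obj E" using f by (auto simp: hom_iff)
  show ?thesis
    using Comp_assoc[OF x q_hom[OF o(1)] Q_arr_spec(1)[OF f]] Comp_assoc[OF x f q_hom[OF o(2)]]
      Q_arr_spec(2)[OF f] by simp
qed

text \<open>A point of \<open>Q A\<close> and a point of \<open>Q B\<close> are lifted to a common
  stage, by one cover elimination inside another. With \<open>A = B\<close> this compares two points
  of one quotient.\<close>

lemma q_cover2_eqI:
  assumes A: "A \<in> Obj E" and B: "B \<in> Obj E" and e: "e \<in> hom E T (Q A)" and e': "e' \<in> hom E T (Q B)"
    and g: "g \<in> hom E T Z" and h: "h \<in> hom E T Z"
    and l: "\<And>U r x y. r \<in> hom E U T \<Longrightarrow> x \<in> hom E U A \<Longrightarrow> y \<in> hom E U B \<Longrightarrow>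
      q A \<cdot> x = e \<cdot> r \<Longrightarrow> q B \<cdot> y = e' \<cdot> r \<Longrightarrow> g \<cdot> r = h \<cdot> r"
  shows "g = h"
proof (rule cover_eqI[OF q_cover[OF A] q_hom[OF A] e g h])
  fix U r x assume r: "r \<in> hom E U T" and x: "x \<in> hom E U A" and xe: "q A \<cdot> x = e \<cdot> r"
  note er = Comp_hom[OF r e'] and gr = Comp_hom[OF r g] and hr = Comp_hom[OF r h]
  show "g \<cdot> r = h \<cdot> r"
  proof (rule cover_eqI[OF q_cover[OF B] q_hom[OF B] er gr hr])
    fix V s y assume s: "s \<in> hom E V U" and y: "y \<in> hom E V B" and ye: "q B \<cdot> y = (e' \<cdot> r) \<cdot> s"
    have "q A \<cdot> (x \<cdot> s) = e \<cdot> (r \<cdot> s)"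
      using Comp_assoc[OF s x q_hom[OF A]] Comp_assoc[OF s r e] xe by simp
    moreover have "q B \<cdot> y = e' \<cdot> (r \<cdot> s)" using Comp_assoc[OF s r e'] ye by simp
    ultimately have "g \<cdot> (r \<cdot> s) = h \<cdot> (r \<cdot> s)"
      by (rule l[OF Comp_hom[OF s r] Comp_hom[OF s x] y])
    then show "(g \<cdot> r) \<cdot> s = (h \<cdot> r) \<cdot> s"
      using Comp_assoc[OF s r g] Comp_assoc[OF s r h] by simp
  qed
qed

section \<open>Preservation of finite products\<close>

lemma Q_terminal:
  assumes T: "is_terminal E T"
  shows "is_terminal E (Q T)"
  unfolding is_terminal_def
proof (intro conjI ballI)
  have o: "T \<in> Obj E" using T by (simp add: is_terminal_def)
  then show "Q T \<in> Obj E" by (rule Q_Obj)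
  fix A assume A: "A \<in> Obj E"
  obtain u where "u \<in> hom E A T" using T A by (auto simp: is_terminal_def)
  then have "q T \<cdot> u \<in> hom E A (Q T)" using q_hom[OF o] by (rule Comp_hom)
  moreover have "f = g" if f: "f \<in> hom E A (Q T)" and g: "g \<in> hom E A (Q T)" for f g
  \<comment> \<open>Both points of \<open>Q T\<close> are lifted to \<open>T\<close>, where the
    lifts coincide.\<close>
  proof (rule q_cover2_eqI[OF o o f g f g])
    fix U r x y assume r: "r \<in> hom E U A" and x: "x \<in> hom E U T" and y: "y \<in> hom E U T"
      and e: "q T \<cdot> x = f \<cdot> r" "q T \<cdot> y = g \<cdot> r"
    have "U \<in> Obj E" using r by (simp add: hom_iff)
    then have "x = y" using T x y unfolding is_terminal_def by blast
    then show "f \<cdot> r = g \<cdot> r" using e by simp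
  qed
  ultimately show "\<exists>!f. f \<in> hom E A (Q T)" by blast
qed

lemma Q_product:
  assumes P: "is_product E P p1 p2 A B"
  shows "is_product E (Q P) (Q_arr p1) (Q_arr p2) (Q A) (Q B)"
proof -
  have p1: "p1 \<in> hom E P A" and p2: "p2 \<in> hom E P B" using P by (auto simp: is_product_def)
  then have o: "P \<in> Obj E" "A \<in> Obj E" "B \<in> Obj E" by (auto simp: hom_iff)
  note Qp1 = Q_arr_spec(1)[OF p1] and Qp2 = Q_arr_spec(1)[OF p2]
  \<comment> \<open>The two projections are jointly monic: lifts of \<open>u\<close> and
    \<open>v\<close> are near in each component, hence near by \<open>near_product\<close>.\<close>
  have eqI: "u = v" if u: "u \<in> hom E T (Q P)" and v: "v \<in> hom E T (Q P)"
    and e1: "Q_arr p1 \<cdot> u = Q_arr p1 \<cdot> v" and e2: "Q_arr p2 \<cdot> u = Q_arr p2 \<cdot> v" for T u v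
  proof (rule q_cover2_eqI[OF o(1,1) u v u v])
    fix U r x y assume r: "r \<in> hom E U T" and x: "x \<in> hom E U P" and y: "y \<in> hom E U P"
      and xu: "q P \<cdot> x = u \<cdot> r" and yv: "q P \<cdot> y = v \<cdot> r"
    have n: "near (p \<cdot> x) (p \<cdot> y)" if p: "p \<in> hom E P C" and e: "Q_arr p \<cdot> u = Q_arr p \<cdot> v" for p C
    proof -
      have C: "C \<in> Obj E" using p by (simp add: hom_iff)
      have "Q_arr p \<cdot> (u \<cdot> r) = Q_arr p \<cdot> (v \<cdot> r)"
        using Comp_assoc[OF r u Q_arr_spec(1)[OF p]] Comp_assoc[OF r v Q_arr_spec(1)[OF p]] e by simp
      then have "q C \<cdot> (p \<cdot> x) = q C \<cdot> (p \<cdot> y)"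
        using Q_arr_q[OF p x] Q_arr_q[OF p y] xu yv by simp
      then show ?thesis using q_eq_iff[OF C Comp_hom[OF x p] Comp_hom[OF y p]] by simp
    qed
    have "near x y" by (rule near_product[OF P x y n[OF p1 e1] n[OF p2 e2]])
    then have "q P \<cdot> x = q P \<cdot> y" using q_eq_iff[OF o(1) x y] by simp
    then show "u \<cdot> r = v \<cdot> r" using xu yv by simp
  qed
  let ?AB = "ProdObj E (Q A) (Q B)" and ?m = "pairing E (Q_arr p1) (Q_arr p2)"
  have m: "?m \<in> hom E (Q P) ?AB" using Qp1 Qp2 by (auto simp: hom_iff)
  have mu: "?m \<cdot> u = pairing E (Q_arr p1 \<cdot> u) (Q_arr p2 \<cdot> u)" if "u \<in> hom E T (Q P)" for T u
    using that Qp1 Qp2 by (simp add: hom_iff)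
  have monic: "is_monic E ?m"
  proof (rule is_monicI[OF m])
    fix T u v assume u: "u \<in> hom E T (Q P)" and v: "v \<in> hom E T (Q P)" and e: "?m \<cdot> u = ?m \<cdot> v"
    show "u = v"
      using e[unfolded mu[OF u] mu[OF v] pairing_inject[OF Comp_hom[OF u Qp1] Comp_hom[OF u Qp2]
        Comp_hom[OF v Qp1] Comp_hom[OF v Qp2]]] eqI[OF u v] by simp
  qed
  \<comment> \<open>The components of \<open>e\<close> are lifted to \<open>A\<close> and
    \<open>B\<close>; the lifts form an element \<open>h\<close> of \<open>P\<close>, and
    \<open>q P \<cdot> h\<close> lifts \<open>e\<close>. The goal is read as an equation between
    \<open>\<omega>\<close> and \<open>true_on E T\<close>, so that \<open>q_cover2_eqI\<close>
    applies.\<close>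
  have "cover ?m"
  proof (rule coverI[OF m])
    fix T e \<omega> assume e: "e \<in> hom E T ?AB" and \<omega>: "\<omega> \<in> hom E T (Om E)"
      and l: "\<And>U r x. r \<in> hom E U T \<Longrightarrow> x \<in> hom E U (Q P) \<Longrightarrow> ?m \<cdot> x = e \<cdot> r \<Longrightarrow> \<omega> \<cdot> r = true_on E U"
    note Qo = Q_Obj[OF o(2)] Q_Obj[OF o(3)]
    let ?e1 = "Pr1 E (Q A) (Q B) \<cdot> e" and ?e2 = "Pr2 E (Q A) (Q B) \<cdot> e"
    have e12: "?e1 \<in> hom E T (Q A)" "?e2 \<in> hom E T (Q B)" using e Qo by (auto simp: hom_iff)
    have T: "true_on E T \<in> hom E T (Om E)" using e by (simp add: hom_iff)
    show "\<omega> = true_on E T"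
    proof (rule q_cover2_eqI[OF o(2,3) e12 \<omega> T])
      fix U r x y assume r: "r \<in> hom E U T" and x: "x \<in> hom E U A" and y: "y \<in> hom E U B"
        and xe: "q A \<cdot> x = ?e1 \<cdot> r" and ye: "q B \<cdot> y = ?e2 \<cdot> r"
      obtain h where h: "h \<in> hom E U P" "p1 \<cdot> h = x" "p2 \<cdot> h = y"
        using P x y unfolding is_product_def by blast
      have qh: "q P \<cdot> h \<in> hom E U (Q P)" by (rule Comp_hom[OF h(1) q_hom[OF o(1)]])
      have "?m \<cdot> (q P \<cdot> h) = pairing E (?e1 \<cdot> r) (?e2 \<cdot> r)"
        unfolding mu[OF qh] Q_arr_q[OF p1 h(1)] Q_arr_q[OF p2 h(1)] h(2,3) xe ye ..
      also have "\<dots> = e \<cdot> r"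
        using pairing_eta[OF Comp_hom[OF r e] Qo] e r Qo by (simp add: hom_iff)
      finally show "\<omega> \<cdot> r = true_on E T \<cdot> r" using l[OF r qh] r by (simp add: hom_iff)
    qed
  qed
  \<comment> \<open>The inverse of the comparison arrow supplies the mediating arrow
    \<open>n \<cdot> pairing E f g\<close>; its uniqueness is \<open>eqI\<close>.\<close>
  from monic_cover_section[OF m monic this] obtain n
    where n: "n \<in> hom E ?AB (Q P)" "?m \<cdot> n = Ide E ?AB" by blast
  have "\<exists>h. h \<in> hom E T (Q P) \<and> Q_arr p1 \<cdot> h = f \<and> Q_arr p2 \<cdot> h = g"
    if f: "f \<in> hom E T (Q A)" and g: "g \<in> hom E T (Q B)" for T f g
  proof -
    have fg: "pairing E f g \<in> hom E T ?AB" using f g by (auto simp: hom_iff)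
    define h where "h = n \<cdot> pairing E f g"
    have h: "h \<in> hom E T (Q P)" unfolding h_def by (rule Comp_hom[OF fg n(1)])
    have "?m \<cdot> h = pairing E f g"
      unfolding h_def Comp_assoc[OF fg n(1) m, symmetric] n(2) by (rule Ide_left[OF fg])
    then have "Q_arr p1 \<cdot> h = f \<and> Q_arr p2 \<cdot> h = g"
      unfolding mu[OF h] pairing_inject[OF Comp_hom[OF h Qp1] Comp_hom[OF h Qp2] f g] .
    with h show ?thesis by blast
  qed
  then show ?thesis unfolding is_product_def using Qp1 Qp2 eqI by (simp add: Ex1_def) metis
qed

end

theorem theoremB2:
  fixes E :: "('o, 'a) topos_data" and \<mu> :: 'a
  assumes "topos E" and "modality E \<mu>"
  shows "(\<forall>X \<in> Obj E. equivalence_relation E X (modal_rel E \<mu> X)) \<and>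
    (\<forall>X \<in> Obj E. is_quotient_map E X (modal_rel E \<mu> X) (modal_quotient_map E \<mu> X)) \<and>
    (\<exists>Q. is_functor E E Q \<and>
         (\<forall>X \<in> Obj E. FObj Q X = modal_quotient E \<mu> X) \<and>
         preserves_finite_products E E Q \<and>
         natural_transformation E E identity_functor Q (modal_quotient_map E \<mu>))"
proof -
  interpret modal_topos E \<mu>
    using assms by (simp add: modal_topos_def modal_topos_axioms_def)
  let ?Q = "\<lparr>FObj = modal_quotient E \<mu>, FArr = Q_arr\<rparr>"
  have "is_functor E E ?Q"
    unfolding is_functor_def by (auto simp: Q_Obj Q_arr_spec(1) Q_arr_Ide Q_arr_comp)
  moreover have "preserves_finite_products E E ?Q"
    unfolding preserves_finite_products_def by (auto simp: Q_terminal Q_product)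
  moreover have "natural_transformation E E identity_functor ?Q (modal_quotient_map E \<mu>)"
    unfolding natural_transformation_def identity_functor_def by (auto simp: q_hom Q_arr_spec(2))
  moreover have "\<forall>X \<in> Obj E. FObj ?Q X = modal_quotient E \<mu> X" by simp
  ultimately have "\<exists>Q. is_functor E E Q \<and> (\<forall>X \<in> Obj E. FObj Q X = modal_quotient E \<mu> X) \<and>
      preserves_finite_products E E Q \<and>
      natural_transformation E E identity_functor Q (modal_quotient_map E \<mu>)"
    by blast
  then show ?thesis using equivalence_relation_modal_rel modal_quotient_map_spec(1) by blast
qed

end
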